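(* Let $N\ge 2$, and let the potentials $V_1,\dots,V_{N-1}:\mathbb{T}\to\mathbb{R}$ be $C^3$-smooth and such that $(V_i'(x))^2+(V_i''(x))^2\neq 0$ for every $x\in\mathbb{T}$ and every $1\le i\le N-1$; moreover (without loss of generality) let $V_i\ge 1$ for every $i$, so that $H\ge 1$ as well. Let $H$, $F$, $\xi_j$, $\gamma_0$, $\alpha_k$ and $W$ (with constants $a_0,\dots,a_{2N-2}\ge 1$) be as defined in the context. Suppose that the constants $a_{2N-2}$ and $a_k-a_{k+1}$ are sufficiently large for all $k$. Then $W$ is a strict Lyapunov function outside a compact set for the system of rotators, and $$L_FW\le -H+C_1\le -C_2W^{1/\gamma_0}+C_1$$ for appropriate constants $C_{1,2}=C_{1,2}(N;a_0,\dots,a_{2N-2})$.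
   Context: $\mathbb{T}$ is the one-dimensional torus (circle). The chain of rotators has phase space $\mathbb{R}^N\times\mathbb{T}^N\ni(p,q)$ and Hamiltonian $$H(p,q)=\sum_{j=1}^N\frac{p_j^2}{2}+\sum_{j=1}^{N-1}V_j(q_j-q_{j+1}).$$ The equations of motion, with friction on the first rotator, are $$\dot q_j=p_j,\qquad \dot p_j=-\delta_{j1}p_1+V_{j-1}'(q_{j-1}-q_j)-V_j'(q_j-q_{j+1}),\qquad 1\le j\le N,$$ where $V_0=V_N:=0$ and $\delta_{j1}$ is the Kronecker symbol. $F$ denotes the vector field on the right-hand side, and $L_Ff=\operatorname{grad}(f)\cdot F$ is the Lie derivative along $F$. For $1\le j\le N-1$ put $\xi_j(q):=-V_j'(q_j-q_{j+1})$. Set $\gamma_0:=2N-1$, $\alpha_k:=2(N-1)-k$ for $1\le k\le 2(N-1)$, and, for constants $a_k\ge 1$, $0\le k\le 2N-2$, $$W(p,q)=a_0H^{\gamma_0}-\sum_{j=1}^{N-1}\Big(a_{2j-1}H^{\alpha_{2j-1}}p_j\xi_j+a_{2j}H^{\alpha_{2j}}\xi_jL_F\xi_j\Big).$$ A function $f$ on a manifold $\mathcal{M}$ is proper if $\{x: f(x)\le c\}$ is compact for every $c\in\mathbb{R}$. A $C^1$-smooth function $W$ on $\mathcal{M}$ is a strict Lyapunov function for $\dot x=F(x)$ outside a compact set if it is proper and there is $Q\in\mathbb{R}$ such that $L_FW(x)<0$ for all $x\in\mathcal{M}$ with $W(x)>Q$. Here $\mathcal{M}=\mathbb{R}^N\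times\mathbb{T}^N$.
   Formalization: "Sufficiently large" is read successively: the threshold for a_k - a_{k+1} may depend on a_{k+1},...,a_{2N-2} (and on N and the potentials); with thresholds independent of the a_k the claim fails, e.g. for N=2 when a_1^2 > 12 a_0 a_2. *)

theory Defs
  imports "HOL-Analysis.Analysis"
begin

text \<open>The circle as the topological group of reals modulo \<open>2 * pi\<close>.\<close>

definition angle_rel :: "real \<Rightarrow> real \<Rightarrow> bool" where
  "angle_rel x y \<longleftrightarrow> (\<exists>k::int. x - y = 2 * pi * of_int k)"

quotient_type circle = real / angle_rel
  morphisms rep_circle circle_of
proof (rule equivpI)
  show "reflp angle_rel"
    by (rule reflpI) (auto simp: angle_rel_def intro: exI[of _ 0])
  show "symp angle_rel"
  proof (rule sympI)
    fix x y assume "angle_rel x y"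
    then obtain k :: int where "x - y = 2 * pi * of_int k"
      by (auto simp: angle_rel_def)
    then have "y - x = 2 * pi * of_int (- k)" by simp
    then show "angle_rel y x" unfolding angle_rel_def by blast
  qed
  show "transp angle_rel"
  proof (rule transpI)
    fix x y z assume "angle_rel x y" "angle_rel y z"
    then obtain k l :: int where "x - y = 2 * pi * of_int k" "y - z = 2 * pi * of_int l"
      by (auto simp: angle_rel_def)
    then have "x - z = 2 * pi * of_int (k + l)" by (simp add: algebra_simps)
    then show "angle_rel x z" unfolding angle_rel_def by blast
  qed
qed

instantiation circle :: ab_group_add
begin

lift_definition zero_circle :: circle is 0 .

lift_definition plus_circle :: "circle \<Rightarrow> circle \<Rightarrow> circle" is "(+)"
proof -
  fix x x' y y' assume "angle_rel x x'" "angle_rel y y'"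
  then obtain k l :: int where "x - x' = 2 * pi * of_int k" "y - y' = 2 * pi * of_int l"
    by (auto simp: angle_rel_def)
  then have "(x + y) - (x' + y') = 2 * pi * of_int (k + l)" by (simp add: algebra_simps)
  then show "angle_rel (x + y) (x' + y')" unfolding angle_rel_def by blast
qed

lift_definition uminus_circle :: "circle \<Rightarrow> circle" is uminus
proof -
  fix x x' assume "angle_rel x x'"
  then obtain k :: int where "x - x' = 2 * pi * of_int k"
    by (auto simp: angle_rel_def)
  then have "- x - - x' = 2 * pi * of_int (- k)" by simp
  then show "angle_rel (- x) (- x')" unfolding angle_rel_def by blast
qed

definition minus_circle :: "circle \<Rightarrow> circle \<Rightarrow> circle" where
  "minus_circle x y = x + - y"

instance
proof
  have refl: "angle_rel u u" for u
    by (auto simp: angle_rel_def intro: exI[of _ 0])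
  fix x y z :: circle
  show "x + y + z = x + (y + z)" by transfer (simp add: add.assoc refl)
  show "x + y = y + x" by transfer (simp add: add.commute refl)
  show "0 + x = x" by transfer (simp add: refl)
  show "- x + x = 0" by transfer (simp add: refl)
  show "x - y = x + - y" by (rule minus_circle_def)
qed

end

instantiation circle :: topological_space
begin

definition open_circle :: "circle set \<Rightarrow> bool" where
  "open_circle U \<longleftrightarrow> open (circle_of -` U)"

instance
  by standard (auto simp: open_circle_def vimage_Union intro: open_Int open_UN)

end

definition circle_deriv :: "(circle \<Rightarrow> real) \<Rightarrow> circle \<Rightarrow> real" where
  "circle_deriv f x = deriv (\<lambda>t. f (x + circle_of t)) 0"

primrec C_smooth :: "nat \<Rightarrow> (circle \<Rightarrow> real) \<Rightarrow> bool" where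
  "C_smooth 0 f \<longleftrightarrow> continuous_on UNIV f"
| "C_smooth (Suc k) f \<longleftrightarrow>
     (\<forall>x. (\<lambda>t. f (x + circle_of t)) differentiable (at 0)) \<and> C_smooth k (circle_deriv f)"

text \<open>
  Points \<open>(p, q)\<close> of \<open>phase_space N\<close> are pairs of functions that are \<open>undefined\<close> outside
  the index set \<open>{1..N}\<close>. Vector fields are likewise written in the order
  (\<open>p\<close>-components, \<open>q\<close>-components).
\<close>

type_synonym point = "(nat \<Rightarrow> real) \<times> (nat \<Rightarrow> circle)"
type_synonym vfield = "point \<Rightarrow> (nat \<Rightarrow> real) \<times> (nat \<Rightarrow> real)"

definition phase_space :: "nat \<Rightarrow> point topology" where
  "phase_space N =
     prod_topology (product_topology (\<lambda>_. euclidean) {1..N}) (product_topology (\<lambda>_. euclidean) {1..N})"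

definition along_p :: "nat \<Rightarrow> (point \<Rightarrow> real) \<Rightarrow> point \<Rightarrow> real \<Rightarrow> real" where
  "along_p j f x t = f ((fst x)(j := fst x j + t), snd x)"

definition along_q :: "nat \<Rightarrow> (point \<Rightarrow> real) \<Rightarrow> point \<Rightarrow> real \<Rightarrow> real" where
  "along_q j f x t = f (fst x, (snd x)(j := snd x j + circle_of t))"

definition partial_p :: "nat \<Rightarrow> (point \<Rightarrow> real) \<Rightarrow> point \<Rightarrow> real" where
  "partial_p j f x = deriv (along_p j f x) 0"

definition partial_q :: "nat \<Rightarrow> (point \<Rightarrow> real) \<Rightarrow> point \<Rightarrow> real" where
  "partial_q j f x = deriv (along_q j f x) 0"

definition C1_smooth :: "nat \<Rightarrow> (point \<Rightarrow> real) \<Rightarrow> bool" where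
  "C1_smooth N f \<longleftrightarrow>
     (\<forall>j\<in>{1..N}.
        (\<forall>x\<in>topspace (phase_space N).
           along_p j f x differentiable (at 0) \<and> along_q j f x differentiable (at 0)) \<and>
        continuous_map (phase_space N) euclideanreal (partial_p j f) \<and>
        continuous_map (phase_space N) euclideanreal (partial_q j f))"

definition lie_deriv :: "nat \<Rightarrow> vfield \<Rightarrow> (point \<Rightarrow> real) \<Rightarrow> point \<Rightarrow> real" where
  "lie_deriv N G f x =
     (\<Sum>j=1..N. partial_p j f x * fst (G x) j) + (\<Sum>j=1..N. partial_q j f x * snd (G x) j)"

definition proper_fun :: "'a topology \<Rightarrow> ('a \<Rightarrow> real) \<Rightarrow> bool" where
  "proper_fun X f \<longleftrightarrow> (\<forall>c. compactin X {x \<in> topspace X. f x \<le> c})"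

definition strict_lyapunov :: "nat \<Rightarrow> vfield \<Rightarrow> (point \<Rightarrow> real) \<Rightarrow> bool" where
  "strict_lyapunov N G f \<longleftrightarrow>
     C1_smooth N f \<and> proper_fun (phase_space N) f \<and>
     (\<exists>Q. \<forall>x\<in>topspace (phase_space N). f x > Q \<longrightarrow> lie_deriv N G f x < 0)"

definition hamiltonian :: "nat \<Rightarrow> (nat \<Rightarrow> circle \<Rightarrow> real) \<Rightarrow> point \<Rightarrow> real" where
  "hamiltonian N V = (\<lambda>(p, q).
     (\<Sum>j=1..N. (p j)\<^sup>2 / 2) + (\<Sum>j=1..N - 1. V j (q j - q (j + 1))))"

text \<open>
  The convention \<open>V\<^sub>0 = V\<^sub>N = 0\<close>. Thanks to it the values \<open>q 0\<close> and \<open>q (N + 1)\<close>, which are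
  not coordinates, are irrelevant in \<open>rotator_field\<close>.
\<close>

definition potential :: "nat \<Rightarrow> (nat \<Rightarrow> circle \<Rightarrow> real) \<Rightarrow> nat \<Rightarrow> circle \<Rightarrow> real" where
  "potential N V j = (if 1 \<le> j \<and> j \<le> N - 1 then V j else (\<lambda>_. 0))"

definition rotator_field :: "nat \<Rightarrow> (nat \<Rightarrow> circle \<Rightarrow> real) \<Rightarrow> vfield" where
  "rotator_field N V = (\<lambda>(p, q).
     (\<lambda>j. - (if j = 1 then p 1 else 0)
          + circle_deriv (potential N V (j - 1)) (q (j - 1) - q j)
          - circle_deriv (potential N V j) (q j - q (j + 1)),
      \<lambda>j. p j))"

definition xi :: "(nat \<Rightarrow> circle \<Rightarrow> real) \<Rightarrow> nat \<Rightarrow> point \<Rightarrow> real" where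
  "xi V j = (\<lambda>(p, q). - circle_deriv (V j) (q j - q (j + 1)))"

definition gamma0 :: "nat \<Rightarrow> nat" where
  "gamma0 N = 2 * N - 1"

definition alpha :: "nat \<Rightarrow> nat \<Rightarrow> nat" where
  "alpha N k = 2 * (N - 1) - k"

definition lyap_W :: "nat \<Rightarrow> (nat \<Rightarrow> circle \<Rightarrow> real) \<Rightarrow> (nat \<Rightarrow> real) \<Rightarrow> point \<Rightarrow> real" where
  "lyap_W N V a x =
     a 0 * hamiltonian N V x ^ gamma0 N
     - (\<Sum>j=1..N - 1.
          a (2 * j - 1) * hamiltonian N V x ^ alpha N (2 * j - 1) * fst x j * xi V j x
        + a (2 * j) * hamiltonian N V x ^ alpha N (2 * j) * xi V j x
            * lie_deriv N (rotator_field N V) (xi V j) x)"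

text \<open>
  The coefficients are chosen successively, from \<open>a\<^bsub>2N-2\<^esub>\<close> down to \<open>a\<^sub>0\<close>: how large
  \<open>a\<^sub>k - a\<^bsub>k+1\<^esub>\<close> has to be may depend on the coefficients
  \<open>a\<^bsub>k+1\<^esub>, \<dots>, a\<^bsub>2N-2\<^esub>\<close> already chosen, and on nothing else about \<open>a\<close>.
  A threshold independent of \<open>a\<close> would not do: for \<open>N = 2\<close> the derivative of \<open>W\<close> along the
  field is unbounded above as soon as \<open>a\<^sub>1\<^sup>2 > 12 * a\<^sub>0 * a\<^sub>2\<close>, even if
  \<open>a\<^sub>0 - a\<^sub>1\<close>, \<open>a\<^sub>1 - a\<^sub>2\<close> and \<open>a\<^sub>2\<close> all exceed a prescribed bound.
\<close>

definition gaps_exceed :: "nat \<Rightarrow> (real list \<Rightarrow> real) \<Rightarrow> (nat \<Rightarrow> real) \<Rightarrow> bool" where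
  "gaps_exceed N \<kappa> a \<longleftrightarrow>
     a (2 * N - 2) \<ge> \<kappa> [] \<and>
     (\<forall>k<2 * N - 2. a k - a (k + 1) \<ge> \<kappa> (map a [k + 1..<2 * N - 1]))"

end

theory Submission
  imports Defs
begin

text \<open>
  Differentiating \<open>W\<close> along the flow produces the dissipation
  \<open>a\<^sub>0 \<gamma>\<^sub>0 H\<^bsup>2N-2\<^esup> p\<^sub>1\<^sup>2 + \<Sum> (a\<^bsub>2j-1\<^esub> H\<^bsup>2N-2j-1\<^esup> \<xi>\<^sub>j\<^sup>2 + a\<^bsub>2j\<^esub> H\<^bsup>2N-2j-2\<^esup> (L\<^sub>F \<xi>\<^sub>j)\<^sup>2)\<close> and error terms. Since
  \<open>L\<^sub>F \<xi>\<^sub>j = - V\<^sub>j'' (p\<^sub>j - p\<^bsub>j+1\<^esub>)\<close> and \<open>V\<^sub>j'\<close>, \<open>V\<^sub>j''\<close> have no common zero, \<open>(L\<^sub>F \<xi>\<^sub>j)\<^sup>2\<close> may be replaced by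
  \<open>c (p\<^sub>j - p\<^bsub>j+1\<^esub>)\<^sup>2\<close> up to a multiple of \<open>H \<xi>\<^sub>j\<^sup>2\<close>. The energy can be large while \<open>p\<^sub>1, \<dots>, p\<^sub>j\<close> are all
  small, so no error may be estimated by a power of \<open>H\<close> alone: the point is that \<open>L\<^sub>F\<^sup>2 \<xi>\<^sub>j\<close> is bounded by
  \<open>(p\<^sub>j - p\<^bsub>j+1\<^esub>)\<^sup>2\<close>, \<open>\<bar>p\<^sub>1\<bar>\<close> and the neighbouring forces \<open>\<bar>\<xi>\<^bsub>j-1\<^esub>\<bar>\<close>, \<open>\<bar>\<xi>\<^sub>j\<bar>\<close>, \<open>\<bar>\<xi>\<^bsub>j+1\<^esub>\<bar>\<close>. Each error then carries the
  coefficient \<open>a\<^sub>i\<close> and a factor belonging to some dissipation term of index \<open>k < i\<close>, and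
  Young's inequality absorbs it once \<open>a\<^sub>k\<close> dominates a multiple of \<open>(1 + \<Sum>\<^bsub>i>k\<^esub> a\<^sub>i)\<^sup>2\<close>. The remaining dissipation controls
  \<open>p\<^sub>1\<^sup>2 + \<Sum> (p\<^sub>j - p\<^bsub>j+1\<^esub>)\<^sup>2\<close> and thereby the kinetic energy, which is \<open>H\<close> up to a bounded amount. In \<open>W\<close> itself every term
  but \<open>a\<^sub>0 H\<^bsup>2N-1\<^esup>\<close> is of lower order.
\<close>

section \<open>Calculus on the circle\<close>

lemma circle_of_add: "circle_of (s + t) = circle_of s + circle_of t"
  by (simp add: plus_circle.abs_eq)

lemma circle_of_0: "circle_of 0 = 0"
  by (simp add: zero_circle_def)

lemma circle_of_minus: "circle_of (- t) = - circle_of t"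
  by (simp add: uminus_circle.abs_eq)

lemma circle_of_diff: "circle_of (s - t) = circle_of s - circle_of t"
  by (metis ab_group_add_class.ab_diff_conv_add_uminus circle_of_add circle_of_minus)

lemma circle_of_eq_iff: "circle_of s = circle_of t \<longleftrightarrow> (\<exists>k::int. s - t = 2 * pi * of_int k)"
  using circle.abs_eq_iff[of s t] by (simp add: angle_rel_def)

lemma circle_of_surj: "\<exists>t. x = circle_of t"
  by (metis Quotient3_abs_rep Quotient3_circle)

lemma continuous_on_circle_of: "continuous_on UNIV circle_of"
  unfolding continuous_on_open_vimage[OF open_UNIV] by (simp add: open_circle_def)

text \<open>The preimage of the image is the union of all period translates of \<open>U\<close>.
  Openness of the projection gives access to maps on products of circles, since a product of
  quotient maps need not be a quotient map.\<close>

lemma open_circle_of_image: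
  assumes "open U"
  shows "open (circle_of ` U)"
proof -
  have "circle_of -` circle_of ` U = (\<Union>k::int. (\<lambda>t. t + 2 * pi * of_int k) -` U)"
  proof safe
    fix t u assume "circle_of t = circle_of u" "u \<in> U"
    then obtain k :: int where "t - u = 2 * pi * of_int k"
      by (auto simp: circle_of_eq_iff)
    then have "t + 2 * pi * of_int (- k) = u" by simp
    with \<open>u \<in> U\<close> show "t \<in> (\<Union>k::int. (\<lambda>t. t + 2 * pi * of_int k) -` U)"
      by (metis UN_iff UNIV_I vimage_eq)
  next
    fix t :: real and k :: int assume "t + 2 * pi * of_int k \<in> U"
    moreover have "circle_of t = circle_of (t + 2 * pi * of_int k)"
      by (auto simp: circle_of_eq_iff intro!: exI[of _ "- k"])
    ultimately show "t \<in> circle_of -` circle_of ` U" by auto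
  qed
  moreover have "open ((\<lambda>t::real. t + 2 * pi * of_int k) -` U)" for k :: int
    by (rule open_vimage[OF assms]) (intro continuous_intros)
  ultimately show ?thesis
    unfolding open_circle_def by auto
qed

lemma compact_UNIV_circle: "compact (UNIV :: circle set)"
proof -
  have "x \<in> circle_of ` {0..2 * pi}" for x
  proof -
    obtain t where t: "x = circle_of t" using circle_of_surj by blast
    define k where "k = \<lfloor>t / (2 * pi)\<rfloor>"
    have "of_int k \<le> t / (2 * pi)" "t / (2 * pi) < of_int k + 1"
      unfolding k_def by linarith+
    then have "t - 2 * pi * of_int k \<in> {0..2 * pi}"
      by (simp add: field_simps)
    moreover have "x = circle_of (t - 2 * pi * of_int k)"
      unfolding t circle_of_eq_iff by auto
    ultimately show ?thesis by blast
  qed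
  then have "UNIV = circle_of ` {0..2 * pi}" by blast
  moreover have "compact (circle_of ` {0..2 * pi})"
    using continuous_on_circle_of
    by (intro compact_continuous_image) (auto intro: continuous_on_subset)
  ultimately show ?thesis by simp
qed

lemma continuous_on_circle_iff:
  fixes f :: "circle \<Rightarrow> 'a::topological_space"
  shows "continuous_on UNIV f \<longleftrightarrow> continuous_on UNIV (\<lambda>t. f (circle_of t))"
  unfolding continuous_on_open_vimage[OF open_UNIV] by (simp add: open_circle_def vimage_def)

text \<open>Subtraction of lifts is continuous, and the open projection carries a product
  neighbourhood of a pair of lifts to one of the pair of angles.\<close>

lemma continuous_on_circle_diff: "continuous_on UNIV (\<lambda>(x, y). x - y :: circle)"
  unfolding continuous_on_open_vimage[OF open_UNIV]
proof (intro allI impI)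
  fix U :: "circle set" assume U: "open U"
  show "open ((\<lambda>(x, y). x - y) -` U \<inter> UNIV)"
    unfolding open_prod_def
  proof safe
    fix x y :: circle assume xy: "x - y \<in> U"
    obtain r s where rs: "x = circle_of r" "y = circle_of s" using circle_of_surj by blast
    have "continuous_on UNIV (\<lambda>z::real \<times> real. fst z - snd z)"
      by (intro continuous_intros)
    with U have "open ((\<lambda>z. fst z - snd z) -` (circle_of -` U))"
      unfolding open_circle_def by (rule open_vimage)
    moreover have "(r, s) \<in> (\<lambda>z. fst z - snd z) -` (circle_of -` U)"
      using xy by (simp add: rs circle_of_diff)
    ultimately obtain A B where AB: "open A" "open B" "(r, s) \<in> A \<times> B"
        "A \<times> B \<subseteq> (\<lambda>z. fst z - snd z) -` (circle_of -` U)"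
      by (rule open_prod_elim)
    show "\<exists>A B. open A \<and> open B \<and> (x, y) \<in> A \<times> B \<and> A \<times> B \<subseteq> (\<lambda>(x, y). x - y) -` U \<inter> UNIV"
    proof (intro exI conjI)
      show "circle_of ` A \<times> circle_of ` B \<subseteq> (\<lambda>(x, y). x - y) -` U \<inter> UNIV"
        using AB(4) by (auto simp flip: circle_of_diff)
    qed (use AB(1-3) rs in \<open>simp_all add: open_circle_of_image\<close>)
  qed
qed

text \<open>\<open>C_smooth\<close> asks for differentiability at parameter 0 only, but for every
  base point; moving the base point gives the derivative at every parameter.\<close>

lemma C_smooth_has_derivative:
  assumes "C_smooth (Suc k) f"
  shows "((\<lambda>t. f (x + circle_of t)) has_real_derivative circle_deriv f (x + circle_of t)) (at t)"
proof -
  have "((\<lambda>h. f (x + circle_of t + circle_of h)) has_real_derivative circle_deriv f (x + circle_of t)) (at 0)"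
    using assms unfolding circle_deriv_def
    by (simp add: DERIV_deriv_iff_real_differentiable)
  moreover have "(\<lambda>h. f (x + circle_of t + circle_of h)) = (\<lambda>h. f (x + circle_of (h + t)))"
    by (simp add: circle_of_add algebra_simps)
  ultimately show ?thesis
    using DERIV_shift[of "\<lambda>t. f (x + circle_of t)" _ 0 t] by simp
qed

text \<open>At a positive level \<open>C_smooth\<close> does not mention continuity of
  \<open>f\<close> itself. At the bottom of the induction it follows from differentiability of the
  lift to the line.\<close>

lemma C_smooth_SucD: "C_smooth (Suc k) f \<Longrightarrow> C_smooth k f"
proof (induction k arbitrary: f)
  case 0
  have "isCont (\<lambda>t. f (circle_of t)) t" for t
    using C_smooth_has_derivative[OF 0, of 0 t] by (simp add: DERIV_isCont)
  then show ?case
    by (simp add: continuous_on_circle_iff continuous_at_imp_continuous_on)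
next
  case (Suc k)
  then show ?case by simp
qed

lemma C_smooth_mono: "C_smooth n f \<Longrightarrow> k \<le> n \<Longrightarrow> C_smooth k f"
  by (induction n arbitrary: f) (auto simp: le_Suc_eq dest: C_smooth_SucD simp del: C_smooth.simps)

lemma C_smooth_continuous: "C_smooth k f \<Longrightarrow> continuous_on UNIV f"
  using C_smooth_mono[of k f 0] by simp

lemma circle_deriv_const [simp]: "circle_deriv (\<lambda>_. c) = (\<lambda>_. 0)"
  by (simp add: circle_deriv_def fun_eq_iff)

lemma bounded_circle_fun:
  fixes f :: "circle \<Rightarrow> real"
  assumes "continuous_on UNIV f"
  obtains B where "\<And>x. \<bar>f x\<bar> \<le> B"
  using compact_imp_bounded[OF compact_continuous_image[OF assms compact_UNIV_circle]]
  by (auto simp: bounded_iff)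

lemma positive_circle_fun:
  fixes f :: "circle \<Rightarrow> real"
  assumes "continuous_on UNIV f" "\<And>x. f x > 0"
  obtains c where "c > 0" "\<And>x. f x \<ge> c"
  using continuous_attains_inf[OF compact_UNIV_circle _ assms(1)] assms(2) by auto

section \<open>Lie derivatives on phase space\<close>

text \<open>Stronger than \<open>C1_smooth\<close>: it adds continuity of \<open>f\<close>, because
  the partial derivatives of a product contain the factors, and differentiability also off
  \<open>phase_space N\<close>, so that partial derivatives are identified as functions on the whole
  type.\<close>

definition C1 :: "nat \<Rightarrow> (point \<Rightarrow> real) \<Rightarrow> bool" where
  "C1 N f \<longleftrightarrow> continuous_map (phase_space N) euclideanreal f \<and>
     (\<forall>j\<in>{1..N}.
        (\<forall>x. along_p j f x differentiable (at 0) \<and> along_q j f x differentiable (at 0)) \<and>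
        continuous_map (phase_space N) euclideanreal (partial_p j f) \<and>
        continuous_map (phase_space N) euclideanreal (partial_q j f))"

lemma C1_imp_C1_smooth: "C1 N f \<Longrightarrow> C1_smooth N f"
  by (auto simp: C1_def C1_smooth_def)

lemma C1_continuous: "C1 N f \<Longrightarrow> continuous_map (phase_space N) euclideanreal f"
  by (simp add: C1_def)

lemma C1_has_partials:
  assumes "C1 N f" "j \<in> {1..N}"
  shows "(along_p j f x has_real_derivative partial_p j f x) (at 0)"
    and "(along_q j f x has_real_derivative partial_q j f x) (at 0)"
    and "continuous_map (phase_space N) euclideanreal (partial_p j f)"
    and "continuous_map (phase_space N) euclideanreal (partial_q j f)"
proof -
  have "along_p j f x differentiable (at 0)" "along_q j f x differentiable (at 0)"
    using assms unfolding C1_def by blast+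
  then show "(along_p j f x has_real_derivative partial_p j f x) (at 0)"
    and "(along_q j f x has_real_derivative partial_q j f x) (at 0)"
    by (simp_all add: partial_p_def partial_q_def DERIV_deriv_iff_real_differentiable)
qed (use assms in \<open>unfold C1_def, blast+\<close>)

lemma partial_p_eqI:
  "(\<And>x. (along_p j f x has_real_derivative P x) (at 0)) \<Longrightarrow> partial_p j f = P"
  by (rule ext) (simp add: partial_p_def DERIV_imp_deriv)

lemma partial_q_eqI:
  "(\<And>x. (along_q j f x has_real_derivative P x) (at 0)) \<Longrightarrow> partial_q j f = P"
  by (rule ext) (simp add: partial_q_def DERIV_imp_deriv)

text \<open>Smoothness and the Lie derivative come from the same candidate partial derivatives, so
  each closure property below arrives together with its differentiation rule.\<close>

lemma C1I:
  assumes "continuous_map (phase_space N) euclideanreal f"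
    and p: "\<And>j x. j \<in> {1..N} \<Longrightarrow> (along_p j f x has_real_derivative P j x) (at 0)"
    and q: "\<And>j x. j \<in> {1..N} \<Longrightarrow> (along_q j f x has_real_derivative Q j x) (at 0)"
    and "\<And>j. j \<in> {1..N} \<Longrightarrow> continuous_map (phase_space N) euclideanreal (P j)"
    and "\<And>j. j \<in> {1..N} \<Longrightarrow> continuous_map (phase_space N) euclideanreal (Q j)"
  shows "C1 N f"
    and "lie_deriv N G f x = (\<Sum>j=1..N. P j x * fst (G x) j) + (\<Sum>j=1..N. Q j x * snd (G x) j)"
proof -
  have "partial_p j f = P j" "partial_q j f = Q j" if "j \<in> {1..N}" for j
    using p q that by (auto intro!: partial_p_eqI partial_q_eqI)
  note partials = this
  have "along_p j f x differentiable (at 0)" "along_q j f x differentiable (at 0)"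
    if "j \<in> {1..N}" for j x
    using p[OF that, of x] q[OF that, of x] unfolding real_differentiable_def by blast+
  then show "C1 N f"
    unfolding C1_def using assms(1,4,5) partials by simp
  show "lie_deriv N G f x = (\<Sum>j=1..N. P j x * fst (G x) j) + (\<Sum>j=1..N. Q j x * snd (G x) j)"
    by (simp add: lie_deriv_def partials)
qed

lemma along_p_0 [simp]: "along_p j f x 0 = f x"
  by (simp add: along_p_def)

lemma along_q_0 [simp]: "along_q j f x 0 = f x"
  by (simp add: along_q_def circle_of_0)

lemma along_p_const [simp]: "along_p j (\<lambda>_. c) x = (\<lambda>_. c)"
  by (simp add: along_p_def fun_eq_iff)

lemma along_q_const [simp]: "along_q j (\<lambda>_. c) x = (\<lambda>_. c)"
  by (simp add: along_q_def fun_eq_iff)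

section \<open>Differentiation rules for sums, products and powers\<close>

lemma
  assumes "C1 N f" "C1 N g"
  shows C1_add: "C1 N (\<lambda>x. f x + g x)"
    and lie_deriv_add: "lie_deriv N G (\<lambda>x. f x + g x) x = lie_deriv N G f x + lie_deriv N G g x"
proof -
  note I = C1I[where f = "\<lambda>x. f x + g x" and P = "\<lambda>j x. partial_p j f x + partial_p j g x"
      and Q = "\<lambda>j x. partial_q j f x + partial_q j g x"]
  note D = C1_has_partials[OF assms(1)] C1_has_partials[OF assms(2)]
  have [simp]: "along_p j (\<lambda>x. f x + g x) x = (\<lambda>t. along_p j f x t + along_p j g x t)"
    "along_q j (\<lambda>x. f x + g x) x = (\<lambda>t. along_q j f x t + along_q j g x t)" for j x
    by (auto simp: along_p_def along_q_def)
  show "C1 N (\<lambda>x. f x + g x)"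
    by (rule I) (use assms in \<open>auto intro!: D DERIV_add continuous_map_add simp: C1_continuous\<close>)
  show "lie_deriv N G (\<lambda>x. f x + g x) x = lie_deriv N G f x + lie_deriv N G g x"
    by (subst I(2)) (use assms in \<open>auto intro!: D DERIV_add continuous_map_add simp: C1_continuous
      lie_deriv_def sum.distrib algebra_simps\<close>)
qed

lemma
  assumes "C1 N f" "C1 N g"
  shows C1_mult: "C1 N (\<lambda>x. f x * g x)"
    and lie_deriv_mult:
      "lie_deriv N G (\<lambda>x. f x * g x) x = lie_deriv N G f x * g x + f x * lie_deriv N G g x"
proof -
  note I = C1I[where f = "\<lambda>x. f x * g x" and P = "\<lambda>j x. partial_p j f x * g x + partial_p j g x * f x"
      and Q = "\<lambda>j x. partial_q j f x * g x + partial_q j g x * f x"]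
  note D = C1_has_partials[OF assms(1)] C1_has_partials[OF assms(2)]
  have [simp]: "along_p j (\<lambda>x. f x * g x) x = (\<lambda>t. along_p j f x t * along_p j g x t)"
    "along_q j (\<lambda>x. f x * g x) x = (\<lambda>t. along_q j f x t * along_q j g x t)" for j x
    by (auto simp: along_p_def along_q_def)
  have P: "((\<lambda>t. along_p j f x t * along_p j g x t) has_real_derivative
      partial_p j f x * g x + partial_p j g x * f x) (at 0)" if "j \<in> {1..N}" for j x
    using DERIV_mult[OF D(1)[OF that] D(5)[OF that]] by simp
  have Q: "((\<lambda>t. along_q j f x t * along_q j g x t) has_real_derivative
      partial_q j f x * g x + partial_q j g x * f x) (at 0)" if "j \<in> {1..N}" for j x
    using DERIV_mult[OF D(2)[OF that] D(6)[OF that]] by simp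
  show "C1 N (\<lambda>x. f x * g x)"
    by (rule I) (use assms in \<open>auto intro!: D P Q continuous_map_add continuous_map_real_mult
        simp: C1_continuous\<close>)
  show "lie_deriv N G (\<lambda>x. f x * g x) x = lie_deriv N G f x * g x + f x * lie_deriv N G g x"
  proof (subst I(2))
    show "(\<Sum>j=1..N. (partial_p j f x * g x + partial_p j g x * f x) * fst (G x) j) +
        (\<Sum>j=1..N. (partial_q j f x * g x + partial_q j g x * f x) * snd (G x) j) =
        lie_deriv N G f x * g x + f x * lie_deriv N G g x"
      unfolding lie_deriv_def distrib_left distrib_right sum.distrib sum_distrib_left sum_distrib_right
      by (simp add: mult_ac)
  qed (use assms in \<open>simp_all add: D P Q continuous_map_add continuous_map_real_mult C1_continuous\<close>)
qed

lemma C1_const: "C1 N (\<lambda>_. c)"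
  by (rule C1I[where P = "\<lambda>_ _. 0" and Q = "\<lambda>_ _. 0"]) auto

lemma lie_deriv_const [simp]: "lie_deriv N G (\<lambda>_. c) x = 0"
  by (subst C1I(2)[where P = "\<lambda>_ _. 0" and Q = "\<lambda>_ _. 0"]) auto

lemma
  assumes "C1 N f"
  shows C1_cmult: "C1 N (\<lambda>x. c * f x)"
    and lie_deriv_cmult: "lie_deriv N G (\<lambda>x. c * f x) x = c * lie_deriv N G f x"
  using C1_mult[OF C1_const assms] lie_deriv_mult[OF C1_const assms] by auto

lemma
  assumes "C1 N f" "C1 N g"
  shows C1_diff: "C1 N (\<lambda>x. f x - g x)"
    and lie_deriv_diff: "lie_deriv N G (\<lambda>x. f x - g x) x = lie_deriv N G f x - lie_deriv N G g x"
  using C1_add[OF assms(1) C1_cmult[OF assms(2), of "-1"]]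
    lie_deriv_add[OF assms(1) C1_cmult[OF assms(2), of "-1"]] lie_deriv_cmult[OF assms(2), of G "-1"]
  by auto

lemma
  assumes "C1 N f"
  shows C1_power: "C1 N (\<lambda>x. f x ^ n)"
    and lie_deriv_power: "lie_deriv N G (\<lambda>x. f x ^ n) x = of_nat n * f x ^ (n - 1) * lie_deriv N G f x"
proof -
  have "C1 N (\<lambda>x. f x ^ n) \<and>
    lie_deriv N G (\<lambda>x. f x ^ n) x = of_nat n * f x ^ (n - 1) * lie_deriv N G f x"
  proof (induction n)
    case 0
    then show ?case by (simp add: C1_const)
  next
    case (Suc n)
    then show ?case
      using C1_mult[OF assms, of "\<lambda>x. f x ^ n"] lie_deriv_mult[OF assms, of "\<lambda>x. f x ^ n" G x]
      by (cases n) (auto simp: algebra_simps)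
  qed
  then show "C1 N (\<lambda>x. f x ^ n)"
    and "lie_deriv N G (\<lambda>x. f x ^ n) x = of_nat n * f x ^ (n - 1) * lie_deriv N G f x"
    by auto
qed

lemma
  assumes "\<And>i. i \<in> I \<Longrightarrow> C1 N (f i)"
  shows C1_sum: "C1 N (\<lambda>x. \<Sum>i\<in>I. f i x)"
    and lie_deriv_sum: "lie_deriv N G (\<lambda>x. \<Sum>i\<in>I. f i x) x = (\<Sum>i\<in>I. lie_deriv N G (f i) x)"
proof -
  have "C1 N (\<lambda>x. \<Sum>i\<in>I. f i x) \<and>
    lie_deriv N G (\<lambda>x. \<Sum>i\<in>I. f i x) x = (\<Sum>i\<in>I. lie_deriv N G (f i) x)"
    using assms
    by (induction I rule: infinite_finite_induct)
      (auto simp: C1_const intro!: C1_add simp: lie_deriv_add)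
  then show "C1 N (\<lambda>x. \<Sum>i\<in>I. f i x)"
    and "lie_deriv N G (\<lambda>x. \<Sum>i\<in>I. f i x) x = (\<Sum>i\<in>I. lie_deriv N G (f i) x)" by auto
qed

section \<open>Momenta and functions of relative angles\<close>

lemma
  assumes "i \<in> {1..N}"
  shows continuous_momentum: "continuous_map (phase_space N) euclideanreal (\<lambda>x. fst x i)"
    and continuous_position: "continuous_map (phase_space N) euclidean (\<lambda>x. snd x i)"
  unfolding phase_space_def
  using continuous_map_compose[OF continuous_map_fst continuous_map_product_projection[OF assms]]
    continuous_map_compose[OF continuous_map_snd continuous_map_product_projection[OF assms]]
  by (auto simp: o_def)

lemma
  assumes "i \<in> {1..N}"
  shows C1_momentum: "C1 N (\<lambda>x. fst x i)"
    and lie_deriv_momentum: "lie_deriv N G (\<lambda>x. fst x i) x = fst (G x) i"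
proof -
  have p: "(along_p j (\<lambda>x. fst x i) x has_real_derivative (if j = i then 1 else 0)) (at 0)" for j x
    by (auto simp: along_p_def [abs_def] intro!: derivative_eq_intros)
  have q: "(along_q j (\<lambda>x. fst x i) x has_real_derivative 0) (at 0)" for j x
    by (simp add: along_q_def [abs_def])
  note I = C1I[OF continuous_momentum[OF assms] p q]
  show "C1 N (\<lambda>x. fst x i)" by (rule I(1)) auto
  show "lie_deriv N G (\<lambda>x. fst x i) x = fst (G x) i"
    by (subst I(2)) (use assms in \<open>auto simp: if_distrib[of "\<lambda>c. c * _"] cong: if_cong\<close>)
qed

lemma prod_topology_euclidean:
  "prod_topology (euclidean :: 'a::topological_space topology) (euclidean :: 'b::topological_space topology) = euclidean"
  unfolding topology_eq openin_prod_topology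
  by (simp only: open_openin[symmetric] open_product_open_eq mem_Collect_eq) simp

lemma continuous_relative_angle:
  assumes "continuous_on UNIV g" "i \<in> {1..N}" "k \<in> {1..N}"
  shows "continuous_map (phase_space N) euclideanreal (\<lambda>x. g (snd x i - snd x k))"
proof -
  have "continuous_map (phase_space N) euclidean (\<lambda>x. (snd x i, snd x k))"
    unfolding prod_topology_euclidean[symmetric]
    using assms(2,3) by (intro continuous_map_pairedI continuous_position)
  moreover have "continuous_on UNIV (\<lambda>(x, y). g (x - y))"
    using continuous_on_compose2[OF assms(1) continuous_on_circle_diff] by (simp add: case_prod_unfold)
  then have "continuous_map euclidean euclideanreal (\<lambda>(x, y). g (x - y))"
    by simp
  ultimately have "continuous_map (phase_space N) euclideanreal ((\<lambda>(x, y). g (x - y)) \<circ> (\<lambda>x. (snd x i, snd x k)))"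
    by (rule continuous_map_compose)
  then show ?thesis
    by (simp add: o_def)
qed

lemma
  assumes g: "C_smooth 1 g" and i: "i \<in> {1..N - 1}"
  shows C1_relative_angle: "C1 N (\<lambda>x. g (snd x i - snd x (i + 1)))"
    and lie_deriv_relative_angle: "lie_deriv N G (\<lambda>x. g (snd x i - snd x (i + 1))) x =
      circle_deriv g (snd x i - snd x (i + 1)) * (snd (G x) i - snd (G x) (i + 1))"
proof -
  let ?r = "\<lambda>x. snd x i - snd x (i + 1)"
  have g': "continuous_on UNIV (circle_deriv g)" and g0: "continuous_on UNIV g"
    using g C_smooth_continuous[OF g] by auto
  have i': "i \<in> {1..N}" "i + 1 \<in> {1..N}" using i by auto
  have p: "(along_p j (\<lambda>x. g (?r x)) x has_real_derivative 0) (at 0)" for j x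
    by (simp add: along_p_def [abs_def])
  have D: "((\<lambda>t. g (y + circle_of t)) has_real_derivative circle_deriv g y) (at 0)" for y
    using C_smooth_has_derivative[of 0 g y 0] g by (simp add: circle_of_0)
  have D': "((\<lambda>t. g (y - circle_of t)) has_real_derivative - circle_deriv g y) (at 0)" for y
    using DERIV_chain2[of "\<lambda>t. g (y + circle_of t)" "circle_deriv g y" uminus 0 "-1" UNIV]
      DERIV_minus[OF DERIV_ident, of "0::real"] D[of y] by (simp add: circle_of_minus)
  \<comment> \<open>Two indicator terms rather than a case distinction: each collapses the sum over
    \<open>j\<close> in the Lie derivative to a single summand.\<close>
  have q: "(along_q j (\<lambda>x. g (?r x)) x has_real_derivative
      ((if j = i then circle_deriv g (?r x) else 0)
       + (if j = i + 1 then - circle_deriv g (?r x) else 0))) (at 0)" for j x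
  proof -
    have "along_q i (\<lambda>x. g (?r x)) x = (\<lambda>t. g (?r x + circle_of t))"
      "along_q (i + 1) (\<lambda>x. g (?r x)) x = (\<lambda>t. g (?r x - circle_of t))"
      by (auto simp: along_q_def fun_eq_iff algebra_simps)
    moreover have "along_q j (\<lambda>x. g (?r x)) x = (\<lambda>_. g (?r x))" if "j \<noteq> i" "j \<noteq> i + 1"
      using that by (simp add: along_q_def fun_eq_iff)
    ultimately show ?thesis
      using D[of "?r x"] D'[of "?r x"] by (cases "j = i"; cases "j = i + 1") simp_all
  qed
  note I = C1I[OF continuous_relative_angle[OF g0 i'] p q]
  have c: "continuous_map (phase_space N) euclideanreal (\<lambda>x. (if j = i then circle_deriv g (?r x) else 0)
       + (if j = i + 1 then - circle_deriv g (?r x) else 0))" for j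
    using continuous_relative_angle[OF g' i'] by (cases "j = i"; cases "j = i + 1") simp_all
  show "C1 N (\<lambda>x. g (?r x))" by (rule I(1)) (simp, rule c)
  have "lie_deriv N G (\<lambda>x. g (?r x)) x = (\<Sum>j=1..N. 0 * fst (G x) j) +
      (\<Sum>j=1..N. ((if j = i then circle_deriv g (?r x) else 0)
        + (if j = i + 1 then - circle_deriv g (?r x) else 0)) * snd (G x) j)"
    by (rule I(2)) (simp, rule c)
  also have "\<dots> = circle_deriv g (?r x) * (snd (G x) i - snd (G x) (i + 1))"
    using i' by (simp add: distrib_right sum.distrib if_distrib[of "\<lambda>c. c * _"] cong: if_cong)
      (simp add: algebra_simps)
  finally show "lie_deriv N G (\<lambda>x. g (?r x)) x = circle_deriv g (?r x) * (snd (G x) i - snd (G x) (i + 1))" .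
qed

section \<open>The pointwise dissipation estimate\<close>

text \<open>Passes from the chain order of the indices to their grouping into one odd and one even
  index for each bond \<open>j\<close>.\<close>

lemma sum_atMost_double:
  fixes g :: "nat \<Rightarrow> real"
  shows "(\<Sum>k\<le>2 * m. g k) = g 0 + (\<Sum>j=1..m. g (2 * j - 1) + g (2 * j))"
  by (induction m) (auto simp: algebra_simps)

text \<open>Young's inequality, from a completed square, for every pair of indices; each square is
  then counted \<open>card A\<close> times. The parameter \<open>e\<close> decides how small the
  share of the second factor is.\<close>

lemma sum_mult_sum_le:
  fixes x y :: "'a \<Rightarrow> real"
  assumes "e > 0"
  shows "(\<Sum>k\<in>A. x k) * (\<Sum>m\<in>A. y m) \<le>
    of_nat (card A) * (e * (\<Sum>m\<in>A. (y m)\<^sup>2) + (\<Sum>k\<in>A. (x k)\<^sup>2) / (4 * e))"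
proof -
  have young: "u * v \<le> e * v\<^sup>2 + u\<^sup>2 / (4 * e)" for u v :: real
  proof -
    have "0 \<le> (2 * e * v - u)\<^sup>2 / (4 * e)" using assms by simp
    also have "\<dots> = e * v\<^sup>2 + u\<^sup>2 / (4 * e) - u * v"
      using assms by (simp add: field_simps power2_eq_square)
    finally show ?thesis by simp
  qed
  have "(\<Sum>k\<in>A. x k) * (\<Sum>m\<in>A. y m) = (\<Sum>k\<in>A. \<Sum>m\<in>A. x k * y m)"
    by (simp add: sum_product)
  also have "\<dots> \<le> (\<Sum>k\<in>A. \<Sum>m\<in>A. e * (y m)\<^sup>2 + (x k)\<^sup>2 / (4 * e))"
    by (intro sum_mono young)
  also have "\<dots> = of_nat (card A) * (e * (\<Sum>m\<in>A. (y m)\<^sup>2) + (\<Sum>k\<in>A. (x k)\<^sup>2) / (4 * e))"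
    by (simp add: sum.distrib sum_distrib_left sum_divide_distrib algebra_simps)
  finally show ?thesis .
qed

text \<open>
  The data of a single phase point: \<open>s = \<surd>H\<close>, and \<open>f2 j\<close>, \<open>f3 j\<close> are the values of \<open>V\<^sub>j''\<close>, \<open>V\<^sub>j'''\<close> there. In these
  terms \<open>F\<close>, \<open>\<eta>\<close>, \<open>\<zeta>\<close> and \<open>lie_value\<close> below are \<open>L\<^sub>F p\<^sub>j\<close>, \<open>L\<^sub>F \<xi>\<^sub>j\<close>, \<open>L\<^sub>F\<^sup>2 \<xi>\<^sub>j\<close> and \<open>L\<^sub>F W\<close>.
\<close>

locale chain_state =
  fixes N :: nat and a :: "nat \<Rightarrow> real" and B c s :: real and p \<xi> f2 f3 :: "nat \<Rightarrow> real"
  assumes N: "N \<ge> 2"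
    and a: "\<And>k. k \<le> 2 * (N - 1) \<Longrightarrow> 1 \<le> a k"
    and B: "1 \<le> B" and c: "0 < c" "c \<le> 1" and s: "1 \<le> s"
    and p: "\<And>j. j \<in> {1..N} \<Longrightarrow> \<bar>p j\<bar> \<le> 2 * s"
    and xi_0: "\<xi> 0 = 0" and xi_N: "\<xi> N = 0"
    and xi: "\<And>j. j \<in> {1..N - 1} \<Longrightarrow> \<bar>\<xi> j\<bar> \<le> B"
    and f2: "\<And>j. j \<in> {1..N - 1} \<Longrightarrow> \<bar>f2 j\<bar> \<le> B"
    and f3: "\<And>j. j \<in> {1..N - 1} \<Longrightarrow> \<bar>f3 j\<bar> \<le> B"
    and nondeg: "\<And>j. j \<in> {1..N - 1} \<Longrightarrow> c \<le> (\<xi> j)\<^sup>2 + (f2 j)\<^sup>2"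
begin

abbreviation n :: nat where "n \<equiv> 2 * (N - 1)"

abbreviation h :: real where "h \<equiv> s\<^sup>2"

definition F :: "nat \<Rightarrow> real" where "F j = - (if j = 1 then p 1 else 0) - \<xi> (j - 1) + \<xi> j"

definition \<eta> :: "nat \<Rightarrow> real" where "\<eta> j = - f2 j * (p j - p (j + 1))"

definition \<zeta> :: "nat \<Rightarrow> real" where
  "\<zeta> j = - f3 j * (p j - p (j + 1))\<^sup>2 - f2 j * (F j - F (j + 1))"

text \<open>
  The chain in the order in which it feels the friction:
  \<open>u\<^sub>0 = \<bar>p\<^sub>1\<bar>\<close>, then \<open>\<bar>\<xi>\<^sub>1\<bar>\<close>, \<open>\<bar>p\<^sub>1 - p\<^sub>2\<bar>\<close>, \<open>\<bar>\<xi>\<^sub>2\<bar>\<close>, \<open>\<bar>p\<^sub>2 - p\<^sub>3\<bar>\<close>, and so on. The weight in \<open>z\<close>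
  is chosen so that \<open>z\<^sub>k\<^sup>2 = H\<^bsup>\<alpha>\<^esup> u\<^sub>k\<^sup>2\<close> with \<open>\<alpha> = \<alpha>\<^sub>k\<close>.
\<close>

definition u :: "nat \<Rightarrow> real" where
  "u k = (if k = 0 then \<bar>p 1\<bar> else if odd k then \<bar>\<xi> ((k + 1) div 2)\<bar>
          else \<bar>p (k div 2) - p (k div 2 + 1)\<bar>)"

definition z :: "nat \<Rightarrow> real" where "z k = s ^ (n - k) * u k"

definition S :: "nat \<Rightarrow> real" where "S k = (\<Sum>i\<in>{k<..n}. a i)"

text \<open>A common majorant of all errors at one phase point. The pair \<open>(k, m)\<close>
  carries \<open>S k\<close>, the total of the coefficients fixed before \<open>a k\<close>.\<close>

definition R :: real where "R = (\<Sum>k\<le>n. S k * z k) * (\<Sum>m\<le>n. z m)"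

lemma u_nonneg [simp]: "0 \<le> u k"
  by (simp add: u_def)

lemma u_0: "u 0 = \<bar>p 1\<bar>"
  by (simp add: u_def)

lemma u_odd: "j \<ge> 1 \<Longrightarrow> u (2 * j - 1) = \<bar>\<xi> j\<bar>"
  by (auto simp: u_def)

lemma u_even: "j \<ge> 1 \<Longrightarrow> u (2 * j) = \<bar>p j - p (j + 1)\<bar>"
  by (auto simp: u_def)

lemma z_nonneg [simp]: "0 \<le> z k"
  using s by (simp add: z_def)

lemma u_le_z: "u k \<le> z k"
  using mult_right_mono[OF one_le_power[OF s], of "u k" "n - k"] by (simp add: z_def)

lemma S_nonneg [simp]: "0 \<le> S k"
  unfolding S_def by (intro sum_nonneg) (use a in \<open>fastforce intro: order_trans[OF zero_le_one]\<close>)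

lemma R_nonneg [simp]: "0 \<le> R"
  by (simp add: R_def sum_nonneg)

lemma z_power2: "(z k)\<^sup>2 = h ^ (n - k) * (u k)\<^sup>2"
  by (simp add: z_def power_mult_distrib power_mult[symmetric] mult.commute)

text \<open>
  Every error term has the shape \<open>a\<^sub>i H\<^bsup>\<alpha>\<^esup> s\<^bsup>e\<^esup> u\<^sub>k u\<^sub>m\<close> with \<open>\<alpha> = \<alpha>\<^sub>i\<close> and one index \<open>k < i\<close>, hence is paid for by
  the coefficient \<open>a\<^sub>k\<close>, which is chosen after \<open>a\<^sub>i\<close>. The hypothesis \<open>e + k + m \<le> 2 i\<close> is the power
  counting in \<open>s\<close>.
\<close>

lemma error_le:
  assumes "k < i" "i \<le> n" "m \<le> n" "e + k + m \<le> 2 * i" "0 \<le> K" "\<bar>t\<bar> \<le> K * (s ^ e * u k * u m)"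
  shows "\<bar>a i * h ^ (n - i) * t\<bar> \<le> K * R"
proof -
  have ai: "0 \<le> a i" using a[of i] assms by simp
  have "h ^ (n - i) * s ^ e = s ^ (2 * (n - i) + e)"
    by (simp add: power_add power_mult)
  also have "\<dots> \<le> s ^ ((n - k) + (n - m))"
    using s assms by (intro power_increasing) auto
  finally have hs: "h ^ (n - i) * s ^ e \<le> s ^ (n - k) * s ^ (n - m)"
    by (simp add: power_add)
  have "\<bar>a i * h ^ (n - i) * t\<bar> \<le> a i * h ^ (n - i) * (K * (s ^ e * u k * u m))"
    using ai assms by (simp add: abs_mult mult_left_mono)
  also have "\<dots> = K * (a i * ((h ^ (n - i) * s ^ e) * (u k * u m)))"
    by (simp add: mult_ac)
  also have "\<dots> \<le> K * (a i * ((s ^ (n - k) * s ^ (n - m)) * (u k * u m)))"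
    using hs ai assms by (intro mult_left_mono mult_right_mono) auto
  also have "\<dots> = K * ((a i * z k) * z m)"
    by (simp add: z_def mult_ac)
  also have "\<dots> \<le> K * R"
  proof -
    have "a i \<le> S k"
      unfolding S_def using assms a by (intro member_le_sum) (auto intro: order_trans[OF zero_le_one])
    then have "a i * z k \<le> S k * z k" by (intro mult_right_mono) auto
    also have "\<dots> \<le> (\<Sum>k\<le>n. S k * z k)"
      using assms by (intro member_le_sum) auto
    finally have "a i * z k \<le> (\<Sum>k\<le>n. S k * z k)" .
    moreover have "z m \<le> (\<Sum>m\<le>n. z m)"
      using assms by (intro member_le_sum) auto
    ultimately show ?thesis
      unfolding R_def using ai assms by (intro mult_left_mono mult_mono) (auto intro!: sum_nonneg)
  qed
  finally show ?thesis .
qed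

text \<open>Differentiating a power of H along the flow brings out the factor
  \<open>(p 1)\<^sup>2\<close>, since the energy decays at exactly that rate. Both factors have
  index 0, which precedes every \<open>i\<close>.\<close>

lemma weight_derivative_error_le:
  fixes K t :: real
  assumes "1 \<le> i" "i \<le> n" "0 \<le> K" "\<bar>t\<bar> \<le> K * s"
  shows "\<bar>a i * (of_nat (n - i) * h ^ (n - i - 1) * (p 1)\<^sup>2 * t)\<bar> \<le> n * K * R"
proof -
  have ai: "0 \<le> a i" using a[of i] assms by simp
  \<comment> \<open>Raising the exponent wastes one power of H. With \<open>e = 1\<close> and
    \<open>k = m = 0\<close> the power count is 1 against \<open>2 * i\<close>, so there is room for
    it.\<close>
  have "of_nat (n - i) * h ^ (n - i - 1) \<le> of_nat n * h ^ (n - i)"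
    using one_le_power[OF s, of 2] by (intro mult_mono power_increasing of_nat_mono) auto
  then have "\<bar>a i * (of_nat (n - i) * h ^ (n - i - 1) * (p 1)\<^sup>2 * t)\<bar> \<le>
      a i * (of_nat n * h ^ (n - i) * (p 1)\<^sup>2 * \<bar>t\<bar>)"
    using ai unfolding abs_mult by (simp add: mult_left_mono mult_right_mono)
  also have "\<dots> = \<bar>a i * h ^ (n - i) * (of_nat n * (p 1)\<^sup>2 * \<bar>t\<bar>)\<bar>"
    using ai by (simp add: abs_mult)
  also have "\<dots> \<le> n * K * R"
  proof (rule error_le[of 0 _ 0 1])
    have "of_nat n * (p 1)\<^sup>2 * \<bar>t\<bar> \<le> of_nat n * (p 1)\<^sup>2 * (K * s)"
      using assms by (intro mult_left_mono) auto
    then show "\<bar>of_nat n * (p 1)\<^sup>2 * \<bar>t\<bar>\<bar> \<le> real n * K * (s ^ 1 * u 0 * u 0)"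
      by (simp add: u_0 abs_mult power2_eq_square mult_ac)
  qed (use assms in auto)
  finally show ?thesis .
qed

text \<open>Telescoping from the damped momentum \<open>p 1\<close>. Only even indices up to
  \<open>2 * j - 2\<close> occur, all of them before the index \<open>2 * j - 1\<close> of the term
  containing \<open>p j\<close>.\<close>

lemma p_le_sum_u: "j \<in> {1..N} \<Longrightarrow> \<bar>p j\<bar> \<le> (\<Sum>l<j. u (2 * l))"
proof (induction j)
  case (Suc j)
  show ?case
  proof (cases "j = 0")
    case False
    then have "\<bar>p j\<bar> \<le> (\<Sum>l<j. u (2 * l))" using Suc by simp
    moreover have "\<bar>p (Suc j)\<bar> \<le> \<bar>p j\<bar> + u (2 * j)" using False by (simp add: u_even)
    ultimately show ?thesis by simp
  qed (simp add: u_0)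
qed simp

section \<open>Dissipation and errors of the individual terms of W\<close>

lemma diff_p_le:
  assumes "j \<in> {1..N - 1}"
  shows "\<bar>p j - p (j + 1)\<bar> \<le> 4 * s"
proof -
  have "j \<in> {1..N}" "j + 1 \<in> {1..N}" using assms by auto
  then show ?thesis using p[of j] p[of "j + 1"] by linarith
qed

lemma xi_mult_pred_error:
  assumes j: "j \<in> {1..N - 1}" and i: "i = 2 * j - 1 \<or> i = 2 * j"
  shows "\<bar>a i * h ^ (n - i) * (\<xi> (j - 1) * \<xi> j)\<bar> \<le> R"
proof (cases "j = 1")
  case True
  then show ?thesis by (simp add: xi_0)
next
  case False
  have "\<bar>a i * h ^ (n - i) * (\<xi> (j - 1) * \<xi> j)\<bar> \<le> 1 * R"
  proof (rule error_le[of "2 * (j - 1) - 1" _ "2 * j - 1" 0])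
    show "\<bar>\<xi> (j - 1) * \<xi> j\<bar> \<le> 1 * (s ^ 0 * u (2 * (j - 1) - 1) * u (2 * j - 1))"
      using j False by (subst (1 2) u_odd) (auto simp: abs_mult)
  qed (use j i False in auto)
  then show ?thesis by simp
qed

lemma p1_xi_error:
  assumes j: "j \<in> {1..N - 1}" and i: "i = 2 * j - 1 \<or> i = 2 * j"
  shows "\<bar>a i * h ^ (n - i) * ((if j = 1 then p 1 else 0) * \<xi> j)\<bar> \<le> R"
proof (cases "j = 1")
  case True
  have "\<bar>a i * h ^ (n - i) * (p 1 * \<xi> 1)\<bar> \<le> 1 * R"
  proof (rule error_le[of 0 _ 1 0])
    show "\<bar>p 1 * \<xi> 1\<bar> \<le> 1 * (s ^ 0 * u 0 * u 1)"
      using u_odd[of 1] by (simp add: abs_mult u_0)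
  qed (use j i True in auto)
  then show ?thesis using True by simp
qed simp

text \<open>The force \<open>\<xi> j\<close> is itself a summand of \<open>F j\<close>, so the
  derivative of \<open>p j * \<xi> j\<close> contains its square. Friction, the left force,
  \<open>p j * \<eta> j\<close> and the derivative of the weight are errors.\<close>

lemma odd_term_ge:
  assumes j: "j \<in> {1..N - 1}"
  defines "i \<equiv> 2 * j - 1"
  shows "a i * (h ^ (n - i) * (F j * \<xi> j + p j * \<eta> j)
      - of_nat (n - i) * h ^ (n - i - 1) * (p 1)\<^sup>2 * (p j * \<xi> j))
    \<ge> a i * (z i)\<^sup>2 - (2 + B * N + 2 * B * n) * R"
proof -
  have i: "1 \<le> i" "i \<le> n" using j by (auto simp: i_def)
  have ui: "u i = \<bar>\<xi> j\<bar>" using j u_odd[of j] by (simp add: i_def)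
  define w where "w = a i * h ^ (n - i)"
  have w: "0 \<le> w" using a[of i] i by (simp add: w_def)
  have FX: "F j * \<xi> j = \<xi> j * \<xi> j - (if j = 1 then p 1 else 0) * \<xi> j - \<xi> (j - 1) * \<xi> j"
    by (simp only: F_def left_diff_distrib distrib_right minus_mult_left[symmetric])
  have zi: "a i * (z i)\<^sup>2 = w * (\<xi> j * \<xi> j)"
    by (simp only: z_power2 ui power2_abs w_def power2_eq_square[of "\<xi> j"] mult.assoc)
  have e1: "\<bar>w * ((if j = 1 then p 1 else 0) * \<xi> j)\<bar> \<le> R"
    unfolding w_def by (rule p1_xi_error) (use j in \<open>auto simp: i_def\<close>)
  have e2: "\<bar>w * (\<xi> (j - 1) * \<xi> j)\<bar> \<le> R"
    unfolding w_def by (rule xi_mult_pred_error) (use j in \<open>auto simp: i_def\<close>)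
  have e3: "\<bar>w * (p j * \<eta> j)\<bar> \<le> B * N * R"
  proof -
    have "\<bar>p j * \<eta> j\<bar> \<le> (\<Sum>l<j. u (2 * l)) * (B * u (2 * j))"
      unfolding abs_mult \<eta>_def using p_le_sum_u[of j] f2[of j] j
      by (intro mult_mono) (auto simp: u_even abs_mult intro!: mult_right_mono sum_nonneg)
    then have "\<bar>w * (p j * \<eta> j)\<bar> \<le> w * ((\<Sum>l<j. u (2 * l)) * (B * u (2 * j)))"
      using w by (simp add: abs_mult mult_left_mono)
    also have "\<dots> = (\<Sum>l<j. w * (B * (u (2 * l) * u (2 * j))))"
      by (simp add: sum_distrib_left sum_distrib_right mult_ac)
    also have "\<dots> \<le> (\<Sum>l<j. B * R)"
    proof (rule sum_mono)
      \<comment> \<open>The power count \<open>2 * l + 2 * j \<le> 2 * i\<close> is exact for the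
        last summand \<open>l = j - 1\<close>.\<close>
      fix l assume l: "l \<in> {..<j}"
      have "\<bar>w * (B * (u (2 * l) * u (2 * j)))\<bar> \<le> B * R"
        unfolding w_def
        by (rule error_le[of "2 * l" _ "2 * j" 0]) (use l j B in \<open>auto simp: i_def abs_mult\<close>)
      then show "w * (B * (u (2 * l) * u (2 * j))) \<le> B * R" by linarith
    qed
    also have "\<dots> = j * (B * R)" by simp
    also have "\<dots> \<le> N * (B * R)" using j B by (intro mult_right_mono) auto
    finally show ?thesis by (simp add: mult_ac)
  qed
  have e4: "\<bar>a i * (of_nat (n - i) * h ^ (n - i - 1) * (p 1)\<^sup>2 * (p j * \<xi> j))\<bar> \<le> n * (2 * B) * R"
  proof (rule weight_derivative_error_le[of i "2 * B" "p j * \<xi> j"])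
    have "\<bar>p j\<bar> * \<bar>\<xi> j\<bar> \<le> (2 * s) * B"
      using p[of j] xi[of j] j s by (intro mult_mono) auto
    then show "\<bar>p j * \<xi> j\<bar> \<le> 2 * B * s" by (simp add: abs_mult mult_ac)
  qed (use i B in auto)
  have eq: "a i * (h ^ (n - i) * (F j * \<xi> j + p j * \<eta> j)
      - of_nat (n - i) * h ^ (n - i - 1) * (p 1)\<^sup>2 * (p j * \<xi> j)) =
    a i * (z i)\<^sup>2 - w * ((if j = 1 then p 1 else 0) * \<xi> j) - w * (\<xi> (j - 1) * \<xi> j) + w * (p j * \<eta> j)
    - a i * (of_nat (n - i) * h ^ (n - i - 1) * (p 1)\<^sup>2 * (p j * \<xi> j))"
    unfolding zi FX w_def by (simp only: right_diff_distrib distrib_left mult.assoc)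
  have R: "(2 + B * N + 2 * B * n) * R = R + R + B * N * R + n * (2 * B) * R"
    by (simp add: algebra_simps)
  have "A - (r1 + r2 + r3 + r4) \<le> A - x1 - x2 + x3 - x4"
    if "\<bar>x1\<bar> \<le> r1" "\<bar>x2\<bar> \<le> r2" "\<bar>x3\<bar> \<le> r3" "\<bar>x4\<bar> \<le> r4" for A x1 x2 x3 x4 r1 r2 r3 r4 :: real
    using that by linarith
  from this[OF e1 e2 e3 e4] show ?thesis unfolding eq R .
qed

text \<open>The square of \<open>\<eta> j\<close> degenerates where \<open>f2 j\<close> vanishes,
  but there \<open>\<xi> j\<close> is bounded away from 0. Nondegeneracy therefore restores the
  squared momentum difference at the cost of \<open>(\<xi> j * d)\<^sup>2\<close>. This cost and all
  of \<open>\<xi> j * \<zeta> j\<close> contain \<open>\<xi> j\<close>, whose index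
  \<open>2 * j - 1\<close> precedes \<open>i\<close>.\<close>

lemma even_term_ge:
  assumes j: "j \<in> {1..N - 1}"
  defines "i \<equiv> 2 * j"
  shows "a i * (h ^ (n - i) * ((\<eta> j)\<^sup>2 + \<xi> j * \<zeta> j)
      - of_nat (n - i) * h ^ (n - i - 1) * (p 1)\<^sup>2 * (\<xi> j * \<eta> j))
    \<ge> c * (a i * (z i)\<^sup>2) - (16 + 9 * B + 4 * B\<^sup>2 * n) * R"
proof -
  have i: "1 \<le> i" "i \<le> n" using j by (auto simp: i_def)
  define d where "d = p j - p (j + 1)"
  have ui: "u i = \<bar>d\<bar>" using j u_even[of j] by (simp add: i_def d_def)
  have d: "\<bar>d\<bar> \<le> 4 * s" using diff_p_le[OF j] by (simp add: d_def)
  have uo: "u (2 * j - 1) = \<bar>\<xi> j\<bar>" using j by (intro u_odd) auto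
  define w where "w = a i * h ^ (n - i)"
  have w: "0 \<le> w" using a[of i] i by (simp add: w_def)
  \<comment> \<open>Bounding both factors \<open>d\<close> by \<open>4 * s\<close> leaves
    \<open>s\<^sup>2\<close> times the squared force; the power count
    \<open>2 + 2 * (2 * j - 1) = 2 * i\<close> is exact.\<close>
  have e1: "\<bar>w * (\<xi> j * d)\<^sup>2\<bar> \<le> 16 * R"
    unfolding w_def
  proof (rule error_le[of "2 * j - 1" _ "2 * j - 1" 2])
    have "\<bar>d\<bar>\<^sup>2 \<le> (4 * s)\<^sup>2" using d by (intro power_mono) auto
    then have "(\<xi> j)\<^sup>2 * d\<^sup>2 \<le> (\<xi> j)\<^sup>2 * (4 * s)\<^sup>2" by (intro mult_left_mono) auto
    moreover have eq: "s\<^sup>2 * u (2 * j - 1) * u (2 * j - 1) = s\<^sup>2 * (\<xi> j)\<^sup>2"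
      by (simp only: uo mult.assoc abs_mult_self_eq power2_eq_square)
    ultimately show "\<bar>(\<xi> j * d)\<^sup>2\<bar> \<le> 16 * (s\<^sup>2 * u (2 * j - 1) * u (2 * j - 1))"
      unfolding eq by (simp add: power_mult_distrib mult_ac)
  qed (use j in \<open>auto simp: i_def\<close>)
  have e2: "\<bar>w * (\<xi> j * f3 j * d\<^sup>2)\<bar> \<le> (4 * B) * R"
    unfolding w_def
  proof (rule error_le[of "2 * j - 1" _ "2 * j" 1])
    have "\<bar>f3 j\<bar> * \<bar>d\<bar> * (\<bar>\<xi> j\<bar> * \<bar>d\<bar>) \<le> B * (4 * s) * (\<bar>\<xi> j\<bar> * \<bar>d\<bar>)"
      using f3[OF j] d B by (intro mult_mono) auto
    then show "\<bar>\<xi> j * f3 j * d\<^sup>2\<bar> \<le> 4 * B * (s ^ 1 * u (2 * j - 1) * u (2 * j))"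
      unfolding uo ui[unfolded i_def] by (simp add: abs_mult power2_eq_square mult_ac)
  qed (use j B in \<open>auto simp: i_def\<close>)
  have e3: "\<bar>w * ((if j = 1 then p 1 else 0) * \<xi> j)\<bar> \<le> R"
    unfolding w_def by (rule p1_xi_error) (use j in \<open>auto simp: i_def\<close>)
  have e4: "\<bar>w * (\<xi> (j - 1) * \<xi> j)\<bar> \<le> R"
    unfolding w_def by (rule xi_mult_pred_error) (use j in \<open>auto simp: i_def\<close>)
  have e5: "\<bar>w * (\<xi> j * \<xi> j)\<bar> \<le> 1 * R"
    unfolding w_def
    by (rule error_le[of "2 * j - 1" _ "2 * j - 1" 0]) (use j in \<open>auto simp: i_def uo[simplified] abs_mult\<close>)
  \<comment> \<open>The right neighbour has the later index \<open>2 * j + 1\<close>, admissible as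
    \<open>m\<close> because \<open>\<xi> j\<close> serves as the earlier factor; the count
    \<open>4 * j = 2 * i\<close> is again exact. At the end of the chain this force is zero.\<close>
  have e6: "\<bar>w * (\<xi> (j + 1) * \<xi> j)\<bar> \<le> R"
  proof (cases "j + 1 = N")
    case False
    have "\<bar>w * (\<xi> (j + 1) * \<xi> j)\<bar> \<le> 1 * R"
      unfolding w_def
    proof (rule error_le[of "2 * j - 1" _ "2 * (j + 1) - 1" 0])
      show "\<bar>\<xi> (j + 1) * \<xi> j\<bar> \<le> 1 * (s ^ 0 * u (2 * j - 1) * u (2 * (j + 1) - 1))"
        using u_odd[of "j + 1"] by (simp add: uo[simplified] abs_mult)
    qed (use j False in \<open>auto simp: i_def\<close>)
    then show ?thesis by simp
  qed (auto simp: xi_N)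
  have e7: "\<bar>a i * (of_nat (n - i) * h ^ (n - i - 1) * (p 1)\<^sup>2 * (\<xi> j * \<eta> j))\<bar> \<le> n * (4 * B\<^sup>2) * R"
  proof (rule weight_derivative_error_le)
    have "\<bar>\<xi> j\<bar> * (\<bar>f2 j\<bar> * \<bar>d\<bar>) \<le> B * (B * (4 * s))"
      using xi[OF j] f2[OF j] d B by (intro mult_mono) auto
    then show "\<bar>\<xi> j * \<eta> j\<bar> \<le> 4 * B\<^sup>2 * s"
      by (simp add: \<eta>_def d_def abs_mult power2_eq_square mult_ac)
  qed (use i B in auto)
  define G where "G = F j - F (j + 1)"
  \<comment> \<open>The own force enters the relative acceleration twice. With friction and the two
    neighbours this makes the five errors counted below.\<close>
  have G: "G * \<xi> j = - ((if j = 1 then p 1 else 0) * \<xi> j) - \<xi> (j - 1) * \<xi> j + 2 * (\<xi> j * \<xi> j)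
      - \<xi> (j + 1) * \<xi> j"
    using j by (auto simp: G_def F_def algebra_simps)
  have "w * (G * \<xi> j) = - (w * ((if j = 1 then p 1 else 0) * \<xi> j)) - w * (\<xi> (j - 1) * \<xi> j)
      + 2 * (w * (\<xi> j * \<xi> j)) - w * (\<xi> (j + 1) * \<xi> j)"
    unfolding G by (simp only: right_diff_distrib distrib_left mult_minus_right mult.left_commute[of w 2])
  moreover have "\<bar>- x1 - x2 + 2 * x3 - x4\<bar> \<le> 5 * r"
    if "\<bar>x1\<bar> \<le> r" "\<bar>x2\<bar> \<le> r" "\<bar>x3\<bar> \<le> 1 * r" "\<bar>x4\<bar> \<le> r" for x1 x2 x3 x4 r :: real
    using that by linarith
  note this[OF e3 e4 e5 e6]
  ultimately have "\<bar>w * (G * \<xi> j)\<bar> \<le> 5 * R" by simp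
  then have "\<bar>f2 j\<bar> * \<bar>w * (G * \<xi> j)\<bar> \<le> B * (5 * R)"
    using f2[OF j] B by (intro mult_mono) auto
  then have e8: "\<bar>w * (\<xi> j * f2 j * G)\<bar> \<le> 5 * B * R"
    by (simp add: abs_mult mult_ac)
  have "c * d\<^sup>2 \<le> ((\<xi> j)\<^sup>2 + (f2 j)\<^sup>2) * d\<^sup>2"
    using nondeg[OF j] by (intro mult_right_mono) auto
  also have "\<dots> = (\<xi> j * d)\<^sup>2 + (\<eta> j)\<^sup>2"
    unfolding \<eta>_def d_def[symmetric] by (simp add: power_mult_distrib distrib_right)
  finally have "w * (c * d\<^sup>2) \<le> w * ((\<xi> j * d)\<^sup>2 + (\<eta> j)\<^sup>2)"
    using w by (intro mult_left_mono)
  then have e9: "c * (a i * (z i)\<^sup>2) - w * (\<xi> j * d)\<^sup>2 \<le> w * (\<eta> j)\<^sup>2"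
    by (simp add: z_power2 ui w_def distrib_left mult_ac)
  have eq': "a i * (h ^ (n - i) * ((\<eta> j)\<^sup>2 + \<xi> j * \<zeta> j)
      - of_nat (n - i) * h ^ (n - i - 1) * (p 1)\<^sup>2 * (\<xi> j * \<eta> j)) =
    w * (\<eta> j)\<^sup>2 - w * (\<xi> j * f3 j * d\<^sup>2) - w * (\<xi> j * f2 j * G)
      - a i * (of_nat (n - i) * h ^ (n - i - 1) * (p 1)\<^sup>2 * (\<xi> j * \<eta> j))"
    unfolding \<zeta>_def w_def d_def[symmetric] G_def[symmetric]
    by (simp only: right_diff_distrib distrib_left mult_minus_left mult_minus_right mult_ac)
  have R: "(16 + 9 * B + 4 * B\<^sup>2 * n) * R = 16 * R + 4 * B * R + 5 * B * R + n * (4 * B\<^sup>2) * R"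
    by (simp add: algebra_simps)
  have "A - (r1 + r2 + r3 + r4) \<le> y - x2 - x3 - x4"
    if "A - x1 \<le> y" "\<bar>x1\<bar> \<le> r1" "\<bar>x2\<bar> \<le> r2" "\<bar>x3\<bar> \<le> r3" "\<bar>x4\<bar> \<le> r4"
    for A y x1 x2 x3 x4 r1 r2 r3 r4 :: real
    using that by linarith
  from this[OF e9 e1 e2 e8 e7] show ?thesis unfolding eq' R .
qed

section \<open>Summation over the chain and absorption of the errors\<close>

definition lie_value :: real where
  "lie_value = - (a 0 * ((of_nat n + 1) * h ^ n * (p 1)\<^sup>2)) - (\<Sum>j=1..N - 1.
     a (2 * j - 1) * (h ^ (n - (2 * j - 1)) * (F j * \<xi> j + p j * \<eta> j)
        - of_nat (n - (2 * j - 1)) * h ^ (n - (2 * j - 1) - 1) * (p 1)\<^sup>2 * (p j * \<xi> j))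
   + a (2 * j) * (h ^ (n - 2 * j) * ((\<eta> j)\<^sup>2 + \<xi> j * \<zeta> j)
        - of_nat (n - 2 * j) * h ^ (n - 2 * j - 1) * (p 1)\<^sup>2 * (\<xi> j * \<eta> j)))"

text \<open>The error constants of one odd and one even term, added and multiplied by
  \<open>N\<close> as a bound for the number of bonds.\<close>

definition error_factor :: real where "error_factor = N * (18 + 9 * B + B * N + 2 * B * n + 4 * B\<^sup>2 * n)"

lemma lie_value_le: "lie_value \<le> error_factor * R - c * (\<Sum>k\<le>n. a k * (z k)\<^sup>2)"
proof -
  define m where "m = 18 + 9 * B + B * N + 2 * B * n + 4 * B\<^sup>2 * n"
  have m: "0 \<le> m" using B by (simp add: m_def)
  \<comment> \<open>Only the even terms lose the factor \<open>c\<close>; since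
    \<open>c \<le> 1\<close>, the others can share it.\<close>
  have 0: "a 0 * ((of_nat n + 1) * h ^ n * (p 1)\<^sup>2) \<ge> c * (a 0 * (z 0)\<^sup>2)"
  proof -
    have "c * (a 0 * (z 0)\<^sup>2) \<le> 1 * (a 0 * (z 0)\<^sup>2)"
      using c a[of 0] by (intro mult_right_mono) auto
    also have "\<dots> \<le> (of_nat n + 1) * (a 0 * (z 0)\<^sup>2)"
      using a[of 0] by (intro mult_right_mono) auto
    finally show ?thesis by (simp add: z_power2 u_0 mult_ac)
  qed
  have terms: "(\<Sum>j=1..N - 1. c * (a (2 * j - 1) * (z (2 * j - 1))\<^sup>2 + a (2 * j) * (z (2 * j))\<^sup>2) - m * R) \<le>
    (\<Sum>j=1..N - 1.
     a (2 * j - 1) * (h ^ (n - (2 * j - 1)) * (F j * \<xi> j + p j * \<eta> j)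
        - of_nat (n - (2 * j - 1)) * h ^ (n - (2 * j - 1) - 1) * (p 1)\<^sup>2 * (p j * \<xi> j))
   + a (2 * j) * (h ^ (n - 2 * j) * ((\<eta> j)\<^sup>2 + \<xi> j * \<zeta> j)
        - of_nat (n - 2 * j) * h ^ (n - 2 * j - 1) * (p 1)\<^sup>2 * (\<xi> j * \<eta> j)))"
  proof (rule sum_mono)
    fix j assume j: "j \<in> {1..N - 1}"
    have "1 \<le> a (2 * j - 1)" using j by (intro a) auto
    then have "c * (a (2 * j - 1) * (z (2 * j - 1))\<^sup>2) \<le> 1 * (a (2 * j - 1) * (z (2 * j - 1))\<^sup>2)"
      using c by (intro mult_right_mono mult_nonneg_nonneg) auto
    then have cx: "c * (a (2 * j - 1) * (z (2 * j - 1))\<^sup>2) \<le> a (2 * j - 1) * (z (2 * j - 1))\<^sup>2"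
      by simp
    have m: "m * R = (2 + B * N + 2 * B * n) * R + (16 + 9 * B + 4 * B\<^sup>2 * n) * R"
      by (simp add: m_def algebra_simps)
    have combine: "c * x + c * y - (r1 + r2) \<le> o1 + e1"
      if "c * x \<le> x" "o1 \<ge> x - r1" "e1 \<ge> c * y - r2" for x y o1 e1 r1 r2 :: real
      using that by linarith
    show "c * (a (2 * j - 1) * (z (2 * j - 1))\<^sup>2 + a (2 * j) * (z (2 * j))\<^sup>2) - m * R \<le>
     a (2 * j - 1) * (h ^ (n - (2 * j - 1)) * (F j * \<xi> j + p j * \<eta> j)
        - of_nat (n - (2 * j - 1)) * h ^ (n - (2 * j - 1) - 1) * (p 1)\<^sup>2 * (p j * \<xi> j))
   + a (2 * j) * (h ^ (n - 2 * j) * ((\<eta> j)\<^sup>2 + \<xi> j * \<zeta> j)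
        - of_nat (n - 2 * j) * h ^ (n - 2 * j - 1) * (p 1)\<^sup>2 * (\<xi> j * \<eta> j))"
      unfolding m distrib_left[of c] by (rule combine[OF cx odd_term_ge[OF j] even_term_ge[OF j]])
  qed
  have sum: "(\<Sum>j=1..N - 1. c * (a (2 * j - 1) * (z (2 * j - 1))\<^sup>2 + a (2 * j) * (z (2 * j))\<^sup>2) - m * R)
    = c * (\<Sum>j=1..N - 1. a (2 * j - 1) * (z (2 * j - 1))\<^sup>2 + a (2 * j) * (z (2 * j))\<^sup>2) - (N - 1) * (m * R)"
    by (simp add: sum_subtractf sum_distrib_left)
  have N1: "(N - 1) * (m * R) \<le> N * (m * R)"
    using m by (intro mult_right_mono) auto
  have error_factor: "error_factor * R = N * (m * R)" by (simp add: error_factor_def m_def mult_ac)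
  have combine: "- A - T \<le> q' - (A' + X)"
    if "A \<ge> A'" "S \<le> T" "S = X - q" "q \<le> q'" for A A' S T X q q' :: real
    using that by linarith
  show ?thesis
    unfolding lie_value_def error_factor sum_atMost_double distrib_left[of c] by (rule combine[OF 0 terms sum N1])
qed

lemma sum_p_le: "(\<Sum>j=1..N. (p j)\<^sup>2 / 2) \<le> real N * real (n + 1) * (\<Sum>k\<le>n. (z k)\<^sup>2)"
proof -
  have "(p j)\<^sup>2 / 2 \<le> (n + 1) * (\<Sum>k\<le>n. (z k)\<^sup>2)" if j: "j \<in> {1..N}" for j
  proof -
    have "\<bar>p j\<bar> \<le> (\<Sum>l<j. u (2 * l))" using p_le_sum_u[OF j] .
    also have "\<dots> = (\<Sum>k\<in>(*) 2 ` {..<j}. u k)"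
      by (subst sum.reindex) (auto simp: inj_on_def)
    also have "\<dots> \<le> (\<Sum>k\<le>n. u k)"
      using j by (intro sum_mono2) auto
    also have "\<dots> \<le> (\<Sum>k\<le>n. z k)" by (intro sum_mono u_le_z)
    finally have "(p j)\<^sup>2 \<le> (\<Sum>k\<le>n. z k)\<^sup>2"
      by (simp add: abs_le_square_iff[symmetric] sum_nonneg)
    \<comment> \<open>With \<open>e = 1/2\<close> and equal factors the estimate becomes the
      Cauchy-Schwarz bound for the square of a sum.\<close>
    also have "\<dots> \<le> of_nat (card {..n}) * (1/2 * (\<Sum>k\<le>n. (z k)\<^sup>2) + (\<Sum>k\<le>n. (z k)\<^sup>2) / (4 * (1/2)))"
      unfolding power2_eq_square[of "sum z {..n}"] by (rule sum_mult_sum_le) simp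
    finally have "(p j)\<^sup>2 \<le> (n + 1) * (\<Sum>k\<le>n. (z k)\<^sup>2)" by simp
    moreover have "0 \<le> (n + 1) * (\<Sum>k\<le>n. (z k)\<^sup>2)" by (simp add: sum_nonneg)
    ultimately show ?thesis by linarith
  qed
  then have "(\<Sum>j=1..N. (p j)\<^sup>2 / 2) \<le> (\<Sum>j=1..N. (n + 1) * (\<Sum>k\<le>n. (z k)\<^sup>2))"
    by (intro sum_mono)
  also have "\<dots> = real N * real (n + 1) * (\<Sum>k\<le>n. (z k)\<^sup>2)"
    by (simp only: sum_constant card_atLeastAtMost diff_Suc_1 mult.assoc)
  finally show ?thesis .
qed

text \<open>The first summand pays for the error \<open>R\<close> after Young's inequality, which
  squares \<open>S k\<close>; the second reserves enough dissipation to bound the kinetic energy. In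
  the threshold the 1 added to \<open>S k\<close> keeps this reserve at the last index, where
  \<open>S k\<close> is 0.\<close>

definition gap_factor :: real where "gap_factor = 2 * ((n + 1) * error_factor / c)\<^sup>2 + 4 * (real N * real (n + 1) / c)"

lemma lie_value_le_kinetic:
  assumes gap: "\<And>k. k \<le> n \<Longrightarrow> a k \<ge> gap_factor * (1 + S k)\<^sup>2"
  shows "lie_value \<le> - (\<Sum>j=1..N. (p j)\<^sup>2 / 2)"
proof -
  have error_factor: "0 \<le> error_factor" using B by (simp add: error_factor_def)
  \<comment> \<open>Multiplied by the \<open>n + 1\<close> indices this is \<open>c / 4\<close>, the
    share of the dissipation given to the second factor of \<open>R\<close>.\<close>
  define e where "e = c / (4 * (n + 1))"
  have e: "e > 0" using c by (simp add: e_def)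
  have "error_factor * R = (\<Sum>k\<le>n. error_factor * (S k * z k)) * (\<Sum>m\<le>n. z m)"
    by (simp only: R_def sum_distrib_left[symmetric] mult.assoc)
  also have "\<dots> \<le> of_nat (card {..n}) * (e * (\<Sum>k\<le>n. (z k)\<^sup>2) + (\<Sum>k\<le>n. (error_factor * (S k * z k))\<^sup>2) / (4 * e))"
    using e by (rule sum_mult_sum_le)
  also have "\<dots> = c / 4 * (\<Sum>k\<le>n. (z k)\<^sup>2) + (n + 1)\<^sup>2 / c * (\<Sum>k\<le>n. (error_factor * (S k * z k))\<^sup>2)"
  proof -
    have "q * (c / (4 * q) * Z + Y / (4 * (c / (4 * q)))) = c / 4 * Z + q\<^sup>2 / c * Y"
      if "q > 0" for q Z Y :: real
      using c that by (simp add: field_simps power2_eq_square)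
    from this[of "real (n + 1)"] show ?thesis by (simp add: e_def)
  qed
  also have "\<dots> = (\<Sum>k\<le>n. c / 4 * (z k)\<^sup>2 + c * (((n + 1) * error_factor / c)\<^sup>2 * (S k)\<^sup>2) * (z k)\<^sup>2)"
    using c by (simp add: sum.distrib sum_distrib_left power_mult_distrib power_divide power2_eq_square[of c] mult_ac)
  also have "\<dots> \<le> (\<Sum>k\<le>n. (c * a k - real N * real (n + 1)) * (z k)\<^sup>2)"
  proof (rule sum_mono)
    fix k assume "k \<in> {..n}"
    then have k: "k \<le> n" by simp
    define A L where "A = ((n + 1) * error_factor / c)\<^sup>2" and "L = real N * real (n + 1)"
    have nonneg: "0 \<le> A" "0 \<le> L / c" using c by (auto simp: A_def L_def)
    have gap_factor: "gap_factor = 2 * A + 4 * (L / c)" by (simp only: gap_factor_def A_def L_def)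
    have "1 \<le> (1 + S k)\<^sup>2" "(S k)\<^sup>2 \<le> (1 + S k)\<^sup>2"
      by (simp_all add: power2_eq_square algebra_simps)
    then have "2 * A * (S k)\<^sup>2 \<le> gap_factor * (1 + S k)\<^sup>2" "4 * (L / c) * 1 \<le> gap_factor * (1 + S k)\<^sup>2"
      unfolding gap_factor using nonneg by (intro mult_mono; simp)+
    then have "2 * A * (S k)\<^sup>2 \<le> a k" "4 * (L / c) \<le> a k"
      using gap[OF k] by auto
    \<comment> \<open>Half of \<open>c * a k\<close> covers the part with \<open>S k\<close>, a
      quarter covers \<open>L\<close>, and a quarter covers \<open>c / 4\<close> because
      \<open>a k\<close> is at least 1.\<close>
    then have "c * (2 * A * (S k)\<^sup>2) \<le> c * a k" "4 * L \<le> c * a k" "c * 1 \<le> c * a k"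
      using c a[OF k] by (auto simp: field_simps intro!: mult_left_mono)
    then have le: "c / 4 + c * (A * (S k)\<^sup>2) \<le> c * a k - L" by linarith
    show "c / 4 * (z k)\<^sup>2 + c * (((n + 1) * error_factor / c)\<^sup>2 * (S k)\<^sup>2) * (z k)\<^sup>2 \<le>
        (c * a k - real N * real (n + 1)) * (z k)\<^sup>2"
      using mult_right_mono[OF le, of "(z k)\<^sup>2"] unfolding A_def L_def distrib_right by simp
  qed
  also have "\<dots> = c * (\<Sum>k\<le>n. a k * (z k)\<^sup>2) - real N * real (n + 1) * (\<Sum>k\<le>n. (z k)\<^sup>2)"
    by (simp only: left_diff_distrib sum_subtractf sum_distrib_left mult.assoc)
  finally show ?thesis using lie_value_le sum_p_le by linarith
qed

section \<open>Size of W relative to its leading term\<close>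

definition correction_factor :: real where
  "correction_factor = (\<Sum>j=1..N - 1. a (2 * j - 1) * (2 * B) + a (2 * j) * (4 * B\<^sup>2))"

lemma correction_factor_nonneg: "0 \<le> correction_factor"
  unfolding correction_factor_def
proof (intro sum_nonneg)
  fix j assume "j \<in> {1..N - 1}"
  then have "1 \<le> a (2 * j - 1)" "1 \<le> a (2 * j)" by (auto intro!: a)
  then show "0 \<le> a (2 * j - 1) * (2 * B) + a (2 * j) * (4 * B\<^sup>2)" using B by simp
qed

text \<open>Each summand is a power of H, at most \<open>h ^ n\<close>, times a factor of order
  \<open>s\<close>. The leading term of W has order \<open>s ^ (2 * n + 2)\<close>, so one power of
  \<open>s\<close> is gained.\<close>

lemma correction_le:
  "\<bar>\<Sum>j=1..N - 1. a (2 * j - 1) * h ^ (n - (2 * j - 1)) * p j * \<xi> j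
      + a (2 * j) * h ^ (n - 2 * j) * \<xi> j * \<eta> j\<bar> \<le> correction_factor * s ^ (2 * n + 1)"
proof -
  have weighted: "\<bar>a i * h ^ (n - i) * t\<bar> \<le> a i * K * s ^ (2 * n + 1)"
    if i: "i \<le> n" and K: "\<bar>t\<bar> \<le> K * s" for i t K
  proof -
    have ai: "0 \<le> a i" using a[OF i] by simp
    have "0 \<le> K * s" using K by linarith
    then have "0 \<le> K" using s by (simp add: zero_le_mult_iff)
    have "\<bar>a i * h ^ (n - i) * t\<bar> \<le> a i * h ^ (n - i) * (K * s)"
      using ai K by (simp add: abs_mult mult_left_mono)
    also have "\<dots> = a i * K * s ^ (2 * (n - i) + 1)"
      by (simp add: power_mult[symmetric] mult_ac)
    also have "\<dots> \<le> a i * K * s ^ (2 * n + 1)"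
      using ai \<open>0 \<le> K\<close> s by (intro mult_left_mono power_increasing) auto
    finally show ?thesis .
  qed
  have "\<bar>a (2 * j - 1) * h ^ (n - (2 * j - 1)) * p j * \<xi> j
      + a (2 * j) * h ^ (n - 2 * j) * \<xi> j * \<eta> j\<bar> \<le>
    (a (2 * j - 1) * (2 * B) + a (2 * j) * (4 * B\<^sup>2)) * s ^ (2 * n + 1)" if j: "j \<in> {1..N - 1}" for j
  proof -
    have "\<bar>p j\<bar> * \<bar>\<xi> j\<bar> \<le> (2 * s) * B"
      using p[of j] xi[of j] j s by (intro mult_mono) auto
    then have "\<bar>p j * \<xi> j\<bar> \<le> (2 * B) * s" by (simp add: abs_mult mult_ac)
    then have 1: "\<bar>a (2 * j - 1) * h ^ (n - (2 * j - 1)) * (p j * \<xi> j)\<bar> \<le>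
        a (2 * j - 1) * (2 * B) * s ^ (2 * n + 1)"
      using j by (intro weighted) auto
    have "\<bar>\<xi> j\<bar> * (\<bar>f2 j\<bar> * \<bar>p j - p (j + 1)\<bar>) \<le> B * (B * (4 * s))"
      using xi[OF j] f2[OF j] diff_p_le[OF j] B by (intro mult_mono) auto
    then have "\<bar>\<xi> j * \<eta> j\<bar> \<le> (4 * B\<^sup>2) * s"
      by (simp add: \<eta>_def abs_mult power2_eq_square mult_ac)
    then have 2: "\<bar>a (2 * j) * h ^ (n - 2 * j) * (\<xi> j * \<eta> j)\<bar> \<le> a (2 * j) * (4 * B\<^sup>2) * s ^ (2 * n + 1)"
      using j by (intro weighted) auto
    show ?thesis
      unfolding distrib_right mult.assoc[of _ "p j" "\<xi> j"] mult.assoc[of _ "\<xi> j" "\<eta> j"]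
      by (rule order_trans[OF abs_triangle_ineq add_mono[OF 1 2]])
  qed
  then show ?thesis
    unfolding correction_factor_def sum_distrib_right by (intro order_trans[OF sum_abs] sum_mono)
qed

end

section \<open>The Lyapunov function of the rotator chain\<close>

lemma uniform_bound_circle_funs:
  fixes f :: "nat \<Rightarrow> circle \<Rightarrow> real"
  assumes "finite I" "\<And>i. i \<in> I \<Longrightarrow> continuous_on UNIV (f i)"
  shows "\<exists>B\<ge>1. \<forall>i\<in>I. \<forall>x. \<bar>f i x\<bar> \<le> B"
  using assms
proof (induction I rule: finite_induct)
  case empty
  then show ?case by auto
next
  case (insert i I)
  then obtain B where B: "1 \<le> B" "\<forall>i\<in>I. \<forall>x. \<bar>f i x\<bar> \<le> B" by auto
  have "continuous_on UNIV (f i)" using insert.prems by simp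
  then obtain b where "\<And>x. \<bar>f i x\<bar> \<le> b"
    using bounded_circle_fun by metis
  then show ?case using B by (intro exI[of _ "max B b"]) (auto simp: le_max_iff_disj)
qed

lemma uniform_positive_circle_funs:
  fixes f :: "nat \<Rightarrow> circle \<Rightarrow> real"
  assumes "finite I" "\<And>i. i \<in> I \<Longrightarrow> continuous_on UNIV (f i)" "\<And>i x. i \<in> I \<Longrightarrow> f i x > 0"
  shows "\<exists>c>0. c \<le> 1 \<and> (\<forall>i\<in>I. \<forall>x. c \<le> f i x)"
  using assms
proof (induction I rule: finite_induct)
  case empty
  then show ?case by (auto intro: exI[of _ 1])
next
  case (insert i I)
  then obtain c where c: "0 < c" "c \<le> 1" "\<forall>i\<in>I. \<forall>x. c \<le> f i x" by auto
  have "continuous_on UNIV (f i)" "\<And>x. f i x > 0" using insert.prems by simp_all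
  then obtain b where "0 < b" "\<And>x. b \<le> f i x"
    using positive_circle_fun by metis
  then show ?case using c by (intro exI[of _ "min c b"]) (auto simp: min_le_iff_disj)
qed

locale rotator_chain =
  fixes N :: nat and V :: "nat \<Rightarrow> circle \<Rightarrow> real"
  assumes N: "N \<ge> 2"
    and smooth: "\<And>i. i \<in> {1..N - 1} \<Longrightarrow> C_smooth 3 (V i)"
    and nondegenerate: "\<And>i x. i \<in> {1..N - 1} \<Longrightarrow>
           (circle_deriv (V i) x)\<^sup>2 + (circle_deriv (circle_deriv (V i)) x)\<^sup>2 \<noteq> 0"
    and V_ge_1: "\<And>i x. i \<in> {1..N - 1} \<Longrightarrow> V i x \<ge> 1"
begin

abbreviation H :: "point \<Rightarrow> real" where "H \<equiv> hamiltonian N V"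

abbreviation lie :: "(point \<Rightarrow> real) \<Rightarrow> point \<Rightarrow> real" where "lie \<equiv> lie_deriv N (rotator_field N V)"

abbreviation angle :: "nat \<Rightarrow> point \<Rightarrow> circle" where "angle j x \<equiv> snd x j - snd x (j + 1)"

abbreviation V1 :: "nat \<Rightarrow> circle \<Rightarrow> real" where "V1 j \<equiv> circle_deriv (V j)"
abbreviation V2 :: "nat \<Rightarrow> circle \<Rightarrow> real" where "V2 j \<equiv> circle_deriv (V1 j)"
abbreviation V3 :: "nat \<Rightarrow> circle \<Rightarrow> real" where "V3 j \<equiv> circle_deriv (V2 j)"

text \<open>Continuing the forces by zero encodes the free ends of the chain and gives all momentum
  equations the same form.\<close>

definition force :: "nat \<Rightarrow> point \<Rightarrow> real" where
  "force j x = (if j \<in> {1..N - 1} then xi V j x else 0)"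

lemma smooth_derivs:
  assumes "j \<in> {1..N - 1}"
  shows "C_smooth 1 (V j)" "C_smooth 1 (V1 j)" "C_smooth 1 (V2 j)"
    and "continuous_on UNIV (V j)" "continuous_on UNIV (V1 j)" "continuous_on UNIV (V2 j)"
      "continuous_on UNIV (V3 j)"
proof -
  have 3: "C_smooth (Suc (Suc (Suc 0))) (V j)" using smooth[OF assms] by (simp add: numeral_3_eq_3)
  then have 2: "C_smooth (Suc (Suc 0)) (V1 j)" and 1: "C_smooth (Suc 0) (V2 j)" and 0: "C_smooth 0 (V3 j)"
    by simp_all
  show "C_smooth 1 (V j)" "C_smooth 1 (V1 j)" "C_smooth 1 (V2 j)"
    using C_smooth_mono[OF 3, of 1] C_smooth_mono[OF 2, of 1] 1 by (simp_all del: C_smooth.simps)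
  show "continuous_on UNIV (V j)" "continuous_on UNIV (V1 j)" "continuous_on UNIV (V2 j)"
      "continuous_on UNIV (V3 j)"
    using C_smooth_continuous[OF 3] C_smooth_continuous[OF 2] C_smooth_continuous[OF 1]
      C_smooth_continuous[OF 0] by blast+
qed

section \<open>Equations of motion and Lie derivatives of H and of the forces\<close>

lemma momentum_equation:
  "fst (rotator_field N V x) j = - (if j = 1 then fst x 1 else 0) - force (j - 1) x + force j x"
  if "j \<ge> 1"
proof -
  have "circle_deriv (potential N V i) (angle i x) = - force i x" for i
    by (auto simp: potential_def force_def xi_def case_prod_unfold)
  from this[of "j - 1"] this[of j] show ?thesis
    using that by (simp add: rotator_field_def case_prod_unfold)
qed

lemma position_equation: "snd (rotator_field N V x) j = fst x j"
  by (simp add: rotator_field_def case_prod_unfold)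

lemma
  assumes "C_smooth 1 g" "j \<in> {1..N - 1}"
  shows C1_angle: "C1 N (\<lambda>x. g (angle j x))"
    and lie_angle: "lie (\<lambda>x. g (angle j x)) x = circle_deriv g (angle j x) * (fst x j - fst x (j + 1))"
  using C1_relative_angle[OF assms] lie_deriv_relative_angle[OF assms] by (simp_all add: position_equation)

lemma hamiltonian_eq: "H = (\<lambda>x. (\<Sum>j=1..N. 1 / 2 * (fst x j)\<^sup>2) + (\<Sum>j=1..N - 1. V j (angle j x)))"
  by (simp add: hamiltonian_def case_prod_unfold)

lemma C1_hamiltonian: "C1 N H"
  unfolding hamiltonian_eq
  by (intro C1_add C1_sum C1_cmult C1_power C1_momentum C1_angle smooth_derivs)

text \<open>For forces \<open>w\<close> and momenta \<open>r\<close> this says that the internal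
  forces only exchange kinetic and potential energy; the boundary terms vanish at both free
  ends.\<close>

lemma summation_by_parts:
  fixes w r :: "nat \<Rightarrow> real"
  assumes "w 0 = 0"
  shows "(\<Sum>j=1..Suc m. r j * (w j - w (j - 1))) + (\<Sum>j=1..m. w j * (r (j + 1) - r j)) = r (Suc m) * w (Suc m)"
  by (induction m) (auto simp: assms algebra_simps)

lemma lie_hamiltonian: "lie H x = - (fst x 1)\<^sup>2"
proof -
  let ?p = "fst x"
  have "lie H x = (\<Sum>j=1..N. ?p j * fst (rotator_field N V x) j)
      + (\<Sum>j=1..N - 1. V1 j (angle j x) * (?p j - ?p (j + 1)))"
  proof -
    have kin: "C1 N (\<lambda>x. 1 / 2 * (fst x j)\<^sup>2)" if "j \<in> {1..N}" for j
      by (intro C1_cmult C1_power C1_momentum that)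
    have pot: "C1 N (\<lambda>x. V j (angle j x))" if "j \<in> {1..N - 1}" for j
      by (intro C1_angle smooth_derivs that)
    have "lie (\<lambda>x. 1 / 2 * (fst x j)\<^sup>2) x = ?p j * fst (rotator_field N V x) j" if "j \<in> {1..N}" for j
      by (simp only: lie_deriv_cmult C1_power C1_momentum that lie_deriv_power lie_deriv_momentum) simp
    moreover have "lie (\<lambda>x. V j (angle j x)) x = V1 j (angle j x) * (?p j - ?p (j + 1))"
      if "j \<in> {1..N - 1}" for j
      by (intro lie_angle smooth_derivs that)
    ultimately show ?thesis
      unfolding hamiltonian_eq
      by (simp only: lie_deriv_add[OF C1_sum[OF kin] C1_sum[OF pot]] lie_deriv_sum[OF kin] lie_deriv_sum[OF pot]
          cong: sum.cong)
  qed
  also have "(\<Sum>j=1..N. ?p j * fst (rotator_field N V x) j) =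
      (\<Sum>j=1..N. (if j = 1 then - (?p 1)\<^sup>2 else 0) + ?p j * (force j x - force (j - 1) x))"
    by (intro sum.cong) (auto simp: momentum_equation algebra_simps power2_eq_square)
  also have "\<dots> = - (?p 1)\<^sup>2 + (\<Sum>j=1..N. ?p j * (force j x - force (j - 1) x))"
    using N by (simp add: sum.distrib)
  also have "(\<Sum>j=1..N - 1. V1 j (angle j x) * (?p j - ?p (j + 1))) =
      (\<Sum>j=1..N - 1. force j x * (?p (j + 1) - ?p j))"
    by (intro sum.cong) (auto simp: force_def xi_def case_prod_unfold algebra_simps)
  finally show ?thesis
    using summation_by_parts[of "\<lambda>j. force j x" ?p "N - 1"] N by (simp add: force_def)
qed

lemma xi_eq: "xi V j = (\<lambda>x. - 1 * V1 j (angle j x))"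
  by (simp add: xi_def case_prod_unfold)

lemma C1_xi: "j \<in> {1..N - 1} \<Longrightarrow> C1 N (xi V j)"
  unfolding xi_eq by (intro C1_cmult C1_angle smooth_derivs)

lemma lie_xi:
  assumes "j \<in> {1..N - 1}"
  shows "lie (xi V j) = (\<lambda>x. - 1 * (V2 j (angle j x) * (fst x j - fst x (j + 1))))"
  unfolding xi_eq
  by (rule ext) (simp only: lie_deriv_cmult C1_angle lie_angle smooth_derivs assms)

text \<open>Here the third derivative of the potentials enters: the Lie derivative of a force
  contains \<open>V2 j\<close>, which must be differentiated once more.\<close>

lemma
  assumes j: "j \<in> {1..N - 1}"
  shows C1_lie_xi: "C1 N (lie (xi V j))"
    and lie_lie_xi: "lie (lie (xi V j)) x = - V3 j (angle j x) * (fst x j - fst x (j + 1))\<^sup>2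
        - V2 j (angle j x) * (fst (rotator_field N V x) j - fst (rotator_field N V x) (j + 1))"
proof -
  have j': "j \<in> {1..N}" "j + 1 \<in> {1..N}" using j by auto
  have v: "C1 N (\<lambda>x. V2 j (angle j x))" by (intro C1_angle smooth_derivs j)
  have d: "C1 N (\<lambda>x. fst x j - fst x (j + 1))" by (intro C1_diff C1_momentum j')
  show "C1 N (lie (xi V j))"
    unfolding lie_xi[OF j] by (intro C1_cmult C1_mult v d)
  have "lie (lie (xi V j)) x = - 1 * (V3 j (angle j x) * (fst x j - fst x (j + 1)) * (fst x j - fst x (j + 1))
      + V2 j (angle j x) * (fst (rotator_field N V x) j - fst (rotator_field N V x) (j + 1)))"
    unfolding lie_xi[OF j]
    by (simp only: lie_deriv_cmult lie_deriv_mult lie_deriv_diff C1_mult v d C1_momentum j' lie_deriv_momentum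
        lie_angle[OF smooth_derivs(3)[OF j] j])
  then show "lie (lie (xi V j)) x = - V3 j (angle j x) * (fst x j - fst x (j + 1))\<^sup>2
        - V2 j (angle j x) * (fst (rotator_field N V x) j - fst (rotator_field N V x) (j + 1))"
    by (simp add: power2_eq_square)
qed

lemma hamiltonian_ge_1: "1 \<le> H x"
  and kinetic_le: "j \<in> {1..N} \<Longrightarrow> (fst x j)\<^sup>2 / 2 \<le> H x"
proof -
  have "(\<Sum>j=1..N - 1. 1) \<le> (\<Sum>j=1..N - 1. V j (angle j x))"
    by (intro sum_mono V_ge_1)
  then have V: "1 \<le> (\<Sum>j=1..N - 1. V j (angle j x))"
    using N by simp
  have kin: "0 \<le> (\<Sum>j=1..N. 1 / 2 * (fst x j)\<^sup>2)" by (intro sum_nonneg) auto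
  show "1 \<le> H x" unfolding hamiltonian_eq using V kin by linarith
  show "(fst x j)\<^sup>2 / 2 \<le> H x" if "j \<in> {1..N}"
    unfolding hamiltonian_eq using V member_le_sum[OF that, of "\<lambda>j. 1 / 2 * (fst x j)\<^sup>2"] by simp
qed

text \<open>Compactness of the circle turns continuity into bounds and the absence of common zeros
  of \<open>V1 j\<close> and \<open>V2 j\<close> into a positive lower bound.\<close>

lemma uniform_constants:
  obtains B c where "1 \<le> B" "0 < c" "c \<le> 1"
    "\<And>j x. j \<in> {1..N - 1} \<Longrightarrow> \<bar>V j x\<bar> \<le> B \<and> \<bar>V1 j x\<bar> \<le> B \<and> \<bar>V2 j x\<bar> \<le> B \<and> \<bar>V3 j x\<bar> \<le> B"
    "\<And>j x. j \<in> {1..N - 1} \<Longrightarrow> c \<le> (V1 j x)\<^sup>2 + (V2 j x)\<^sup>2"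
proof -
  have bound: "\<exists>b\<ge>1. \<forall>j\<in>{1..N - 1}. \<forall>x. \<bar>f j x\<bar> \<le> b"
    if "\<And>j. j \<in> {1..N - 1} \<Longrightarrow> continuous_on UNIV (f j)" for f :: "nat \<Rightarrow> circle \<Rightarrow> real"
    using that by (intro uniform_bound_circle_funs) auto
  obtain b0 where b0: "1 \<le> b0" "\<forall>j\<in>{1..N - 1}. \<forall>x. \<bar>V j x\<bar> \<le> b0"
    using bound[of "\<lambda>j. V j", OF smooth_derivs(4)] by auto
  obtain b1 where b1: "1 \<le> b1" "\<forall>j\<in>{1..N - 1}. \<forall>x. \<bar>V1 j x\<bar> \<le> b1"
    using bound[of "\<lambda>j. V1 j", OF smooth_derivs(5)] by auto
  obtain b2 where b2: "1 \<le> b2" "\<forall>j\<in>{1..N - 1}. \<forall>x. \<bar>V2 j x\<bar> \<le> b2"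
    using bound[of "\<lambda>j. V2 j", OF smooth_derivs(6)] by auto
  obtain b3 where b3: "1 \<le> b3" "\<forall>j\<in>{1..N - 1}. \<forall>x. \<bar>V3 j x\<bar> \<le> b3"
    using bound[of "\<lambda>j. V3 j", OF smooth_derivs(7)] by auto
  have "\<exists>c>0. c \<le> 1 \<and> (\<forall>j\<in>{1..N - 1}. \<forall>x. c \<le> (V1 j x)\<^sup>2 + (V2 j x)\<^sup>2)"
  proof (rule uniform_positive_circle_funs)
    show "continuous_on UNIV (\<lambda>x. (V1 j x)\<^sup>2 + (V2 j x)\<^sup>2)" if "j \<in> {1..N - 1}" for j
      by (intro continuous_intros smooth_derivs that)
    show "0 < (V1 j x)\<^sup>2 + (V2 j x)\<^sup>2" if "j \<in> {1..N - 1}" for j x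
      using nondegenerate[OF that, of x] by (simp add: order_le_neq_trans sum_power2_ge_zero)
  qed simp
  then obtain c where c: "0 < c" "c \<le> 1" "\<forall>j\<in>{1..N - 1}. \<forall>x. c \<le> (V1 j x)\<^sup>2 + (V2 j x)\<^sup>2"
    by blast
  let ?B = "b0 + b1 + b2 + b3"
  show thesis
  proof (rule that[of ?B c])
    show "\<bar>V j x\<bar> \<le> ?B \<and> \<bar>V1 j x\<bar> \<le> ?B \<and> \<bar>V2 j x\<bar> \<le> ?B \<and> \<bar>V3 j x\<bar> \<le> ?B"
      if "j \<in> {1..N - 1}" for j x
    proof -
      have "\<bar>V j x\<bar> \<le> b0" "\<bar>V1 j x\<bar> \<le> b1" "\<bar>V2 j x\<bar> \<le> b2" "\<bar>V3 j x\<bar> \<le> b3"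
        using b0(2) b1(2) b2(2) b3(2) that by blast+
      then show ?thesis using b0(1) b1(1) b2(1) b3(1) by linarith
    qed
  qed (use b0 b1 b2 b3 c in auto)
qed

lemma C1_lyap_W: "C1 N (lyap_W N V a)"
  and lie_lyap_W: "lie (lyap_W N V a) x = - (a 0 * (of_nat (gamma0 N) * H x ^ (gamma0 N - 1) * (fst x 1)\<^sup>2))
    - (\<Sum>j=1..N - 1.
        a (2 * j - 1) * (H x ^ alpha N (2 * j - 1) *
            (fst (rotator_field N V x) j * xi V j x + fst x j * lie (xi V j) x)
          - of_nat (alpha N (2 * j - 1)) * H x ^ (alpha N (2 * j - 1) - 1) * (fst x 1)\<^sup>2 * (fst x j * xi V j x))
      + a (2 * j) * (H x ^ alpha N (2 * j) * ((lie (xi V j) x)\<^sup>2 + xi V j x * lie (lie (xi V j)) x)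
          - of_nat (alpha N (2 * j)) * H x ^ (alpha N (2 * j) - 1) * (fst x 1)\<^sup>2 * (xi V j x * lie (xi V j) x)))"
proof -
  note C1_H = C1_hamiltonian C1_power[OF C1_hamiltonian]
  let ?f = "\<lambda>j x. a (2 * j - 1) * H x ^ alpha N (2 * j - 1) * fst x j * xi V j x
    + a (2 * j) * H x ^ alpha N (2 * j) * xi V j x * lie (xi V j) x"
  have W: "lyap_W N V a = (\<lambda>x. a 0 * H x ^ gamma0 N - (\<Sum>j=1..N - 1. ?f j x))"
    by (simp add: lyap_W_def fun_eq_iff)
  have C1_f: "C1 N (?f j)" if j: "j \<in> {1..N - 1}" for j
  proof -
    have "j \<in> {1..N}" using j by auto
    with j show ?thesis by (intro C1_add C1_mult C1_const C1_H C1_momentum C1_xi C1_lie_xi)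
  qed
  have lie_f: "lie (?f j) x =
      a (2 * j - 1) * (H x ^ alpha N (2 * j - 1) *
            (fst (rotator_field N V x) j * xi V j x + fst x j * lie (xi V j) x)
          - of_nat (alpha N (2 * j - 1)) * H x ^ (alpha N (2 * j - 1) - 1) * (fst x 1)\<^sup>2 * (fst x j * xi V j x))
      + a (2 * j) * (H x ^ alpha N (2 * j) * ((lie (xi V j) x)\<^sup>2 + xi V j x * lie (lie (xi V j)) x)
          - of_nat (alpha N (2 * j)) * H x ^ (alpha N (2 * j) - 1) * (fst x 1)\<^sup>2 * (xi V j x * lie (xi V j) x))"
    if j: "j \<in> {1..N - 1}" for j
  proof -
    have j': "j \<in> {1..N}" using j by auto
    \<comment> \<open>Coefficient and power of H are differentiated together; the product rule below
      is instantiated so that it does not split them. For exponent 0 the truncated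
      \<open>k - 1\<close> is harmless because \<open>of_nat k\<close> vanishes.\<close>
    have aH: "lie (\<lambda>x. b * H x ^ k) x = - (b * (of_nat k * H x ^ (k - 1) * (fst x 1)\<^sup>2))" for b k
      by (simp add: lie_deriv_cmult lie_deriv_power C1_H lie_hamiltonian)
    have "lie (?f j) x =
      - (a (2 * j - 1) * (of_nat (alpha N (2 * j - 1)) * H x ^ (alpha N (2 * j - 1) - 1) * (fst x 1)\<^sup>2)) * fst x j * xi V j x
      + (a (2 * j - 1) * H x ^ alpha N (2 * j - 1)) * fst (rotator_field N V x) j * xi V j x
      + (a (2 * j - 1) * H x ^ alpha N (2 * j - 1)) * fst x j * lie (xi V j) x
      + (- (a (2 * j) * (of_nat (alpha N (2 * j)) * H x ^ (alpha N (2 * j) - 1) * (fst x 1)\<^sup>2)) * xi V j x * lie (xi V j) x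
      + (a (2 * j) * H x ^ alpha N (2 * j)) * lie (xi V j) x * lie (xi V j) x
      + (a (2 * j) * H x ^ alpha N (2 * j)) * xi V j x * lie (lie (xi V j)) x)"
      by (simp only: lie_deriv_add lie_deriv_mult[of N "\<lambda>x. _ x * _ x"] lie_deriv_mult[of N "\<lambda>x. a _ * H x ^ _"]
          aH C1_mult C1_const C1_H C1_momentum[OF j'] C1_xi[OF j] C1_lie_xi[OF j]
          lie_deriv_momentum[OF j'] distrib_right)
    then show ?thesis
      by (simp only: right_diff_distrib distrib_left power2_eq_square[of "lie (xi V j) x"] mult_minus_left
          mult_minus_right mult_ac)
  qed
  show "C1 N (lyap_W N V a)"
    unfolding W by (intro C1_diff C1_cmult C1_sum C1_H C1_f)
  have "lie (lyap_W N V a) x = a 0 * lie (\<lambda>x. H x ^ gamma0 N) x - (\<Sum>j=1..N - 1. lie (?f j) x)"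
    unfolding W by (simp only: lie_deriv_diff lie_deriv_cmult lie_deriv_sum C1_cmult C1_sum C1_H C1_f)
  also have "a 0 * lie (\<lambda>x. H x ^ gamma0 N) x = - (a 0 * (of_nat (gamma0 N) * H x ^ (gamma0 N - 1) * (fst x 1)\<^sup>2))"
    by (simp add: lie_deriv_power C1_H lie_hamiltonian)
  finally show "lie (lyap_W N V a) x = - (a 0 * (of_nat (gamma0 N) * H x ^ (gamma0 N - 1) * (fst x 1)\<^sup>2))
    - (\<Sum>j=1..N - 1.
        a (2 * j - 1) * (H x ^ alpha N (2 * j - 1) *
            (fst (rotator_field N V x) j * xi V j x + fst x j * lie (xi V j) x)
          - of_nat (alpha N (2 * j - 1)) * H x ^ (alpha N (2 * j - 1) - 1) * (fst x 1)\<^sup>2 * (fst x j * xi V j x))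
      + a (2 * j) * (H x ^ alpha N (2 * j) * ((lie (xi V j) x)\<^sup>2 + xi V j x * lie (lie (xi V j)) x)
          - of_nat (alpha N (2 * j)) * H x ^ (alpha N (2 * j) - 1) * (fst x 1)\<^sup>2 * (xi V j x * lie (xi V j) x)))"
    by (simp only: lie_f cong: sum.cong)
qed

end

locale bounded_rotator_chain = rotator_chain N V for N V +
  fixes B c :: real and a :: "nat \<Rightarrow> real"
  assumes B: "1 \<le> B" and c: "0 < c" "c \<le> 1"
    and bounds: "\<And>j x. j \<in> {1..N - 1} \<Longrightarrow>
      \<bar>V j x\<bar> \<le> B \<and> \<bar>V1 j x\<bar> \<le> B \<and> \<bar>V2 j x\<bar> \<le> B \<and> \<bar>V3 j x\<bar> \<le> B"
    and nondeg: "\<And>j x. j \<in> {1..N - 1} \<Longrightarrow> c \<le> (V1 j x)\<^sup>2 + (V2 j x)\<^sup>2"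
    and a: "\<And>k. k \<le> 2 * (N - 1) \<Longrightarrow> 1 \<le> a k"
begin

text \<open>Every phase point is an instance of the pointwise estimates. The kinetic energy gives
  \<open>(fst x j)\<^sup>2 \<le> 2 * H x\<close>, rounded up to 4 to have a rational factor after
  taking roots.\<close>

lemma chain_state_at:
  "chain_state N a B c (sqrt (H x)) (fst x) (\<lambda>j. force j x) (\<lambda>j. V2 j (angle j x)) (\<lambda>j. V3 j (angle j x))"
proof
  show "\<bar>fst x j\<bar> \<le> 2 * sqrt (H x)" if "j \<in> {1..N}" for j
  proof -
    have "(fst x j)\<^sup>2 \<le> 4 * H x" using kinetic_le[OF that, of x] hamiltonian_ge_1[of x] by linarith
    then have "sqrt ((fst x j)\<^sup>2) \<le> sqrt (4 * H x)" by (rule real_sqrt_le_mono)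
    then show ?thesis by (simp add: real_sqrt_mult)
  qed
  show "1 \<le> sqrt (H x)" using hamiltonian_ge_1[of x] by simp
  show "\<bar>force j x\<bar> \<le> B" if "j \<in> {1..N - 1}" for j
    using bounds[OF that, of "angle j x"] that by (simp add: force_def xi_eq)
  show "c \<le> (force j x)\<^sup>2 + (V2 j (angle j x))\<^sup>2" if "j \<in> {1..N - 1}" for j
    using nondeg[OF that, of "angle j x"] that by (simp add: force_def xi_eq)
qed (use N B c a bounds in \<open>auto simp: force_def\<close>)

text \<open>The potential energy is bounded, so dissipation of the kinetic energy is dissipation of
  H up to the constant \<open>N * B\<close>.\<close>

lemma hamiltonian_le: "H x \<le> (\<Sum>j=1..N. (fst x j)\<^sup>2 / 2) + N * B"
proof -
  have "(\<Sum>j=1..N - 1. V j (angle j x)) \<le> (\<Sum>j=1..N - 1. B)"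
    by (intro sum_mono) (use bounds in \<open>fastforce simp: abs_le_iff\<close>)
  also have "\<dots> = real (N - 1) * B" by simp
  also have "\<dots> \<le> N * B" using B by (intro mult_right_mono) auto
  finally show ?thesis unfolding hamiltonian_eq by simp
qed

lemma lie_lyap_W_le:
  assumes "\<And>k. k \<le> 2 * (N - 1) \<Longrightarrow> a k \<ge> chain_state.gap_factor N B c * (1 + (\<Sum>i\<in>{k<..2 * (N - 1)}. a i))\<^sup>2"
  shows "lie (lyap_W N V a) x \<le> - H x + N * B"
proof -
  interpret S: chain_state N a B c "sqrt (H x)" "fst x" "\<lambda>j. force j x"
    "\<lambda>j. V2 j (angle j x)" "\<lambda>j. V3 j (angle j x)"
    by (rule chain_state_at)
  have H: "(sqrt (H x))\<^sup>2 = H x" using hamiltonian_ge_1[of x] by simp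
  have F: "fst (rotator_field N V x) j = S.F j" if "j \<ge> 1" for j
    using momentum_equation[OF that, of x] by (simp add: S.F_def)
  have eta: "lie (xi V j) x = S.\<eta> j" and xi: "xi V j x = force j x"
    and zeta: "lie (lie (xi V j)) x = S.\<zeta> j" if j: "j \<in> {1..N - 1}" for j
  proof -
    have j1: "j \<ge> 1" "j + 1 \<ge> 1" using j by auto
    show "lie (xi V j) x = S.\<eta> j" unfolding lie_xi[OF j] S.\<eta>_def by simp
    show "xi V j x = force j x" using j by (simp add: force_def)
    show "lie (lie (xi V j)) x = S.\<zeta> j"
      unfolding lie_lie_xi[OF j] S.\<zeta>_def F[OF j1(1)] F[OF j1(2)] by simp
  qed
  \<comment> \<open>Identifies the coefficient and the exponent of the leading dissipation with the
    \<open>n + 1\<close> and \<open>n\<close> of \<open>lie_value\<close>.\<close>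
  have \<gamma>: "gamma0 N = 2 * (N - 1) + 1" using N by (simp add: gamma0_def)
  have "lie (lyap_W N V a) x = S.lie_value"
    unfolding lie_lyap_W S.lie_value_def H \<gamma> alpha_def
    by (intro arg_cong2[of _ _ _ _ "(-)"] sum.cong) (simp_all add: eta xi zeta F)
  also have "\<dots> \<le> - (\<Sum>j=1..N. (fst x j)\<^sup>2 / 2)"
    using assms by (intro S.lie_value_le_kinetic) (simp add: S.S_def)
  finally show ?thesis using hamiltonian_le[of x] by linarith
qed

section \<open>Comparison of W with powers of H, and properness\<close>

lemma lyap_W_close:
  "\<bar>lyap_W N V a x - a 0 * H x ^ gamma0 N\<bar> \<le> chain_state.correction_factor N a B * sqrt (H x) ^ (4 * (N - 1) + 1)"
proof -
  interpret S: chain_state N a B c "sqrt (H x)" "fst x" "\<lambda>j. force j x"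
    "\<lambda>j. V2 j (angle j x)" "\<lambda>j. V3 j (angle j x)"
    by (rule chain_state_at)
  have H: "(sqrt (H x))\<^sup>2 = H x" using hamiltonian_ge_1[of x] by simp
  have eq: "a 0 * H x ^ gamma0 N - lyap_W N V a x = (\<Sum>j=1..N - 1.
      a (2 * j - 1) * (sqrt (H x))\<^sup>2 ^ (2 * (N - 1) - (2 * j - 1)) * fst x j * force j x
      + a (2 * j) * (sqrt (H x))\<^sup>2 ^ (2 * (N - 1) - 2 * j) * force j x * S.\<eta> j)"
  proof -
    have "lie (xi V j) x = S.\<eta> j" "xi V j x = force j x" if j: "j \<in> {1..N - 1}" for j
      unfolding lie_xi[OF j] S.\<eta>_def using j by (simp_all add: force_def)
    then show ?thesis
      unfolding lyap_W_def H alpha_def by simp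
  qed
  show ?thesis
    using S.correction_le unfolding eq[symmetric] by (simp add: abs_minus_commute)
qed

lemma correction_factor_nonneg: "0 \<le> chain_state.correction_factor N a B"
  using chain_state.correction_factor_nonneg[OF chain_state_at] .

lemma lyap_W_le: "lyap_W N V a x \<le> (a 0 + chain_state.correction_factor N a B) * H x ^ gamma0 N"
proof -
  have s: "1 \<le> sqrt (H x)" using hamiltonian_ge_1[of x] by simp
  have "sqrt (H x) ^ (4 * (N - 1) + 1) \<le> sqrt (H x) ^ (2 * gamma0 N)"
    using s N by (intro power_increasing) (auto simp: gamma0_def)
  also have "\<dots> = H x ^ gamma0 N"
    using hamiltonian_ge_1[of x] by (simp add: power_mult)
  finally have "chain_state.correction_factor N a B * sqrt (H x) ^ (4 * (N - 1) + 1) \<le> chain_state.correction_factor N a B * H x ^ gamma0 N"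
    using correction_factor_nonneg by (intro mult_left_mono)
  then show ?thesis
    using lyap_W_close[of x] by (simp add: distrib_right abs_le_iff)
qed

text \<open>\<open>root\<close> is increasing on the whole real line, so the upper bound for W
  passes through it whatever the sign of W.\<close>

lemma lyap_W_root_le: "root (gamma0 N) (lyap_W N V a x) \<le> root (gamma0 N) (a 0 + chain_state.correction_factor N a B) * H x"
proof -
  have g: "0 < gamma0 N" using N by (simp add: gamma0_def)
  have "root (gamma0 N) (lyap_W N V a x) \<le> root (gamma0 N) ((a 0 + chain_state.correction_factor N a B) * H x ^ gamma0 N)"
    using g lyap_W_le by (rule real_root_le_mono)
  also have "\<dots> = root (gamma0 N) (a 0 + chain_state.correction_factor N a B) * H x"
    using g hamiltonian_ge_1[of x] by (simp add: real_root_mult real_root_power_cancel)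
  finally show ?thesis .
qed

text \<open>With \<open>s = sqrt (H x)\<close> and \<open>D\<close> the correction factor, W is at
  least \<open>(a 0 * s - D) * s ^ (4 * (N - 1) + 1)\<close>. Once \<open>s\<close> exceeds
  \<open>D + 1\<close> the first factor is at least 1, and W is at least \<open>s\<close>.\<close>

lemma lyap_W_sublevel:
  assumes "lyap_W N V a x \<le> b"
  shows "sqrt (H x) \<le> max (chain_state.correction_factor N a B + 1) b"
proof (cases "sqrt (H x) \<le> chain_state.correction_factor N a B + 1")
  case False
  define s where "s = sqrt (H x)"
  define D where "D = chain_state.correction_factor N a B"
  have s: "1 \<le> s" using hamiltonian_ge_1[of x] by (simp add: s_def)
  have "H x ^ gamma0 N = s ^ (2 * gamma0 N)"
    using hamiltonian_ge_1[of x] by (simp add: s_def power_mult)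
  also have "2 * gamma0 N = Suc (4 * (N - 1) + 1)" using N by (simp add: gamma0_def)
  finally have "H x ^ gamma0 N = s * s ^ (4 * (N - 1) + 1)" by simp
  then have W: "(a 0 * s - D) * s ^ (4 * (N - 1) + 1) \<le> lyap_W N V a x"
    using lyap_W_close[of x] unfolding D_def[symmetric] s_def[symmetric]
    by (simp add: left_diff_distrib abs_le_iff mult.assoc)
  have "s \<le> a 0 * s" using a[of 0] s by simp
  then have "1 \<le> a 0 * s - D" using False by (simp add: s_def D_def)
  moreover have "s ^ 1 \<le> s ^ (4 * (N - 1) + 1)" using s by (intro power_increasing) auto
  ultimately have "1 * s \<le> (a 0 * s - D) * s ^ (4 * (N - 1) + 1)"
    using s by (intro mult_mono) auto
  then show ?thesis using W assms by (simp add: s_def)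
qed simp

text \<open>A sublevel set is closed by continuity and lies in a product of intervals and circles;
  the circles are compact, so only the momenta have to be bounded.\<close>

lemma proper_lyap_W: "proper_fun (phase_space N) (lyap_W N V a)"
  unfolding proper_fun_def
proof
  fix b :: real
  define r where "r = 2 * max (chain_state.correction_factor N a B + 1) b"
  let ?K = "(\<Pi>\<^sub>E j\<in>{1..N}. {-r..r}) \<times> (\<Pi>\<^sub>E j\<in>{1..N}. (UNIV :: circle set))"
  have "compactin (phase_space N) ?K"
    unfolding phase_space_def compactin_Times compactin_PiE using compact_UNIV_circle by simp
  moreover have "{x \<in> topspace (phase_space N). lyap_W N V a x \<le> b} \<subseteq> ?K"
  proof
    fix x assume x: "x \<in> {x \<in> topspace (phase_space N). lyap_W N V a x \<le> b}"
    have "fst x j \<in> {-r..r}" if "j \<in> {1..N}" for j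
    proof -
      have "\<bar>fst x j\<bar> \<le> 2 * sqrt (H x)"
        using chain_state.p[OF chain_state_at that] .
      also have "\<dots> \<le> r" using lyap_W_sublevel[of x b] x by (simp add: r_def)
      finally show ?thesis by auto
    qed
    with x show "x \<in> ?K"
      by (cases x) (auto simp: phase_space_def PiE_iff)
  qed
  moreover have "closedin (phase_space N) {x \<in> topspace (phase_space N). lyap_W N V a x \<le> b}"
  proof -
    have "closedin (phase_space N) {x \<in> topspace (phase_space N). lyap_W N V a x \<in> {..b}}"
      by (rule closedin_continuous_map_preimage[OF C1_continuous[OF C1_lyap_W]]) simp
    then show ?thesis by simp
  qed
  ultimately show "compactin (phase_space N) {x \<in> topspace (phase_space N). lyap_W N V a x \<le> b}"
    by (rule closed_compactin)
qed

lemma strict_lyapunov_lyap_W: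
  assumes "\<And>x. lie (lyap_W N V a) x \<le> - H x + C" "0 \<le> C"
  shows "strict_lyapunov N (rotator_field N V) (lyap_W N V a)"
  unfolding strict_lyapunov_def
proof (intro conjI exI ballI impI)
  let ?A = "a 0 + chain_state.correction_factor N a B"
  \<comment> \<open>The witness for \<open>Q\<close> is the largest value the upper bound of W
    allows while H is at most \<open>C\<close>; beyond it H exceeds \<open>C\<close> and the
    derivative is negative.\<close>
  fix x assume Q: "?A * C ^ gamma0 N < lyap_W N V a x"
  have "C < H x"
  proof (rule ccontr)
    assume "\<not> C < H x"
    then have "?A * H x ^ gamma0 N \<le> ?A * C ^ gamma0 N"
      using hamiltonian_ge_1[of x] a[of 0] correction_factor_nonneg by (intro mult_left_mono power_mono) auto
    then show False using Q lyap_W_le[of x] by linarith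
  qed
  then show "lie (lyap_W N V a) x < 0" using assms(1)[of x] by linarith
qed (simp_all add: C1_imp_C1_smooth C1_lyap_W proper_lyap_W)

end

text \<open>Since \<open>a (k + 1)\<close> is positive, a lower bound on the gap is one on
  \<open>a k\<close>. The list passed to the threshold sums to the total of the later coefficients
  and is empty at the last index.\<close>

lemma gaps_exceedD:
  assumes gaps: "gaps_exceed N (\<lambda>l. K * (1 + sum_list l)\<^sup>2) a" and N: "N \<ge> 2"
    and a: "\<And>k. k \<le> 2 * N - 2 \<Longrightarrow> 1 \<le> a k" and k: "k \<le> 2 * (N - 1)"
  shows "a k \<ge> K * (1 + (\<Sum>i\<in>{k<..2 * (N - 1)}. a i))\<^sup>2"
proof (cases "k = 2 * (N - 1)")
  case True
  then show ?thesis using gaps by (simp add: gaps_exceed_def right_diff_distrib')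
next
  case False
  then have k': "k < 2 * N - 2" using k by simp
  have "{k + 1..<2 * N - 1} = {k<..2 * (N - 1)}" using N by auto
  then have "sum_list (map a [k + 1..<2 * N - 1]) = (\<Sum>i\<in>{k<..2 * (N - 1)}. a i)"
    by (simp add: interv_sum_list_conv_sum_set_nat)
  then show ?thesis
    using gaps k' a[of "k + 1"] unfolding gaps_exceed_def by (smt (verit) Suc_leI Suc_eq_plus1)
qed

theorem theorem3p1:
  fixes N :: nat and V :: "nat \<Rightarrow> circle \<Rightarrow> real"
  assumes "N \<ge> 2"
    and "\<And>i. i \<in> {1..N - 1} \<Longrightarrow> C_smooth 3 (V i)"
    and "\<And>i x. i \<in> {1..N - 1} \<Longrightarrow>
           (circle_deriv (V i) x)\<^sup>2 + (circle_deriv (circle_deriv (V i)) x)\<^sup>2 \<noteq> 0"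
    and "\<And>i x. i \<in> {1..N - 1} \<Longrightarrow> V i x \<ge> 1"
  shows "\<exists>\<kappa> :: real list \<Rightarrow> real. \<forall>a :: nat \<Rightarrow> real.
           (\<forall>k\<le>2 * N - 2. a k \<ge> 1) \<and> gaps_exceed N \<kappa> a \<longrightarrow>
           strict_lyapunov N (rotator_field N V) (lyap_W N V a) \<and>
           (\<exists>C\<^sub>1>0. \<exists>C\<^sub>2>0. \<forall>x\<in>topspace (phase_space N).
              lie_deriv N (rotator_field N V) (lyap_W N V a) x \<le> - hamiltonian N V x + C\<^sub>1 \<and>
              - hamiltonian N V x + C\<^sub>1
                \<le> - C\<^sub>2 * root (gamma0 N) (lyap_W N V a x) + C\<^sub>1)"
proof -
  interpret rotator_chain N V using assms by unfold_locales
  obtain B c where Bc: "1 \<le> B" "0 < c" "c \<le> 1"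
    "\<And>j x. j \<in> {1..N - 1} \<Longrightarrow> \<bar>V j x\<bar> \<le> B \<and> \<bar>V1 j x\<bar> \<le> B \<and> \<bar>V2 j x\<bar> \<le> B \<and> \<bar>V3 j x\<bar> \<le> B"
    "\<And>j x. j \<in> {1..N - 1} \<Longrightarrow> c \<le> (V1 j x)\<^sup>2 + (V2 j x)\<^sup>2"
    using uniform_constants by blast
  \<comment> \<open>The threshold sees the coefficients already chosen only through their sum, and
    its factor depends on \<open>N\<close>, \<open>B\<close> and \<open>c\<close> alone, which are
    fixed before \<open>a\<close>.\<close>
  show ?thesis
  proof (intro exI[of _ "\<lambda>l. chain_state.gap_factor N B c * (1 + sum_list l)\<^sup>2"] allI impI)
    fix a :: "nat \<Rightarrow> real"
    assume large: "(\<forall>k\<le>2 * N - 2. 1 \<le> a k) \<and> gaps_exceed N (\<lambda>l. chain_state.gap_factor N B c * (1 + sum_list l)\<^sup>2) a"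
    then have a1: "\<And>k. k \<le> 2 * (N - 1) \<Longrightarrow> 1 \<le> a k" by (simp add: right_diff_distrib')
    interpret bounded_rotator_chain N V B c a
      by unfold_locales (use Bc a1 in auto)
    have le: "lie (lyap_W N V a) x \<le> - H x + N * B" for x
      using large by (intro lie_lyap_W_le gaps_exceedD[OF conjunct2[OF large] N]) simp_all
    let ?r = "root (gamma0 N) (a 0 + chain_state.correction_factor N a B)"
    have r: "0 < ?r"
      using correction_factor_nonneg N a1[of 0] by (simp add: gamma0_def)
    have NB: "0 < N * B" using N Bc(1) by simp
    show "strict_lyapunov N (rotator_field N V) (lyap_W N V a) \<and>
         (\<exists>C\<^sub>1>0. \<exists>C\<^sub>2>0. \<forall>x\<in>topspace (phase_space N).
            lie (lyap_W N V a) x \<le> - H x + C\<^sub>1 \<and>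
            - H x + C\<^sub>1 \<le> - C\<^sub>2 * root (gamma0 N) (lyap_W N V a x) + C\<^sub>1)"
    proof (intro conjI)
      show "strict_lyapunov N (rotator_field N V) (lyap_W N V a)"
        using strict_lyapunov_lyap_W[OF le] NB by simp
      \<comment> \<open>The constants are \<open>N * B\<close> and the reciprocal of
        \<open>?r\<close>, the root of the factor in the upper bound for W.\<close>
      have "- H x + N * B \<le> - (1 / ?r) * root (gamma0 N) (lyap_W N V a x) + N * B" for x
        using lyap_W_root_le[of x] r by (simp add: field_simps)
      moreover have "0 < 1 / ?r" using r by simp
      ultimately show "\<exists>C\<^sub>1>0. \<exists>C\<^sub>2>0. \<forall>x\<in>topspace (phase_space N).
            lie (lyap_W N V a) x \<le> - H x + C\<^sub>1 \<and>
            - H x + C\<^sub>1 \<le> - C\<^sub>2 * root (gamma0 N) (lyap_W N V a x) + C\<^sub>1"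
        using le NB by blast
    qed
  qed
qed

end
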